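(* Let $G$ be a finite simple connected graph on $n$ vertices and let $w:E(G)\to\mathbb{R}_{>0}$ be a positive edge-weighting. For each edge $e\in E(G)$ define $C_w(e)$ to be the maximum of $w(C)=\sum_{f\in E(C)}w(f)$ over all cycles $C\subseteq G$ with $e\in E(C)$ if $e$ lies on some cycle, and $C_w(e)=2w(e)$ if $e$ is a bridge. Then $$\sum_{e\in E(G)}\frac{w(e)}{C_w(e)}\le \frac{n-1}{2}.$$
   Context: A bridge is an edge lying on no cycle. For a subgraph $H$, $w(H)=\sum_{e\in E(H)}w(e)$. *)

theory Defs
  imports Complex_Main
begin

text \<open>A finite simple graph: vertex set V, edge set E of 2-element subsets of V.\<close>
definition simple_graph :: "'a set \<Rightarrow> 'a set set \<Rightarrow> bool" where
  "simple_graph V E \<longleftrightarrow> finite V \<and> (\<forall>e\<in>E. e \<subseteq> V \<and> card e = 2)"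

definition adj :: "'a set set \<Rightarrow> 'a \<Rightarrow> 'a \<Rightarrow> bool" where
  "adj E u v \<longleftrightarrow> {u, v} \<in> E"

text \<open>Connected: nonempty and any two vertices are joined by a walk.\<close>
definition connected_graph :: "'a set \<Rightarrow> 'a set set \<Rightarrow> bool" where
  "connected_graph V E \<longleftrightarrow> V \<noteq> {} \<and>
     (\<forall>u\<in>V. \<forall>v\<in>V. (u, v) \<in> {(x, y). adj E x y}\<^sup>*)"

text \<open>Edge set of the closed cycle v_0 v_1 ... v_(k-1) v_0 given by a vertex list.\<close>
definition cycle_edges :: "'a list \<Rightarrow> 'a set set" where
  "cycle_edges xs = {{xs ! i, xs ! ((i + 1) mod length xs)} | i. i < length xs}"

text \<open>A cycle of G: at least 3 distinct vertices, consecutive ones (cyclically) adjacent.\<close>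
definition is_cycle :: "'a set \<Rightarrow> 'a set set \<Rightarrow> 'a list \<Rightarrow> bool" where
  "is_cycle V E xs \<longleftrightarrow> length xs \<ge> 3 \<and> distinct xs \<and> set xs \<subseteq> V \<and> cycle_edges xs \<subseteq> E"

text \<open>Weight of a subgraph given by its edge set.\<close>
definition weight :: "('a set \<Rightarrow> real) \<Rightarrow> 'a set set \<Rightarrow> real" where
  "weight w F = (\<Sum>f\<in>F. w f)"

text \<open>C_w(e): max weight of a cycle through e, or 2 w(e) if e is a bridge (on no cycle).\<close>
definition Cw :: "'a set \<Rightarrow> 'a set set \<Rightarrow> ('a set \<Rightarrow> real) \<Rightarrow> 'a set \<Rightarrow> real" where
  "Cw V E w e = (if \<exists>xs. is_cycle V E xs \<and> e \<in> cycle_edges xs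
     then Max {weight w (cycle_edges xs) | xs. is_cycle V E xs \<and> e \<in> cycle_edges xs}
     else 2 * w e)"

end

theory Submission
  imports Defs
begin

text \<open>
  Replacing \<open>w\<close> by \<open>w e / Cw V E w e\<close> makes every cycle weigh at most 1 and every bridge weigh
  exactly \<open>1/2\<close>, so the claim becomes a form of the Bondy--Fan theorem: if all cycles weigh at most
  \<open>M\<close> and bridges are counted with weight \<open>M/2\<close>, the total weight is at most \<open>(n - 1) M / 2\<close>. This
  is proved by induction on \<open>n\<close>, splitting at cut vertices. If the graph is 2-connected and not
  just a Hamilton cycle, let \<open>C\<close> be a heaviest non-Hamiltonian cycle, of weight \<open>m = M - \<delta>\<close> and
  length \<open>c\<close>. A long detour through a component of the complement of \<open>C\<close> would give a cycle heavier
  than \<open>M\<close>; this forces a vertex \<open>z\<close> off \<open>C\<close> with \<open>2 deg z \<le> m + c \<delta>\<close>. All cycles avoiding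
  \<open>z\<close> weigh at most \<open>m\<close>. Bridges that appear on deleting \<open>z\<close> weigh at most \<open>M/2\<close>, an excess of
  \<open>\<delta>/2\<close> each, and there are at most \<open>n - 1 - c\<close> of them; the two error terms in \<open>\<delta>\<close> add up exactly
  to the \<open>(n - 1) \<delta> / 2\<close> lost by passing from \<open>M\<close> to \<open>m\<close>.
\<close>

subsection \<open>Lists and reachability\<close>

text \<open>The walk is extended edge by edge and cut back to the earlier visit whenever a vertex
  repeats.\<close>

lemma rtrancl_distinct_path:
  assumes "(x, y) \<in> r\<^sup>*"
  shows "\<exists>xs. xs \<noteq> [] \<and> hd xs = x \<and> last xs = y \<and> distinct xs \<and> successively (\<lambda>u v. (u, v) \<in> r) xs"
  using assms
proof (induction rule: rtrancl_induct)
  case base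
  show ?case by (rule exI[of _ "[x]"]) auto
next
  case (step y z)
  then obtain xs where xs: "xs \<noteq> []" "hd xs = x" "last xs = y" "distinct xs"
    "successively (\<lambda>u v. (u, v) \<in> r) xs" by blast
  show ?case
  proof (cases "z \<in> set xs")
    case True
    then obtain as bs where s: "xs = as @ z # bs" by (meson split_list)
    show ?thesis using xs s
      by (intro exI[of _ "as @ [z]"]) (auto simp: successively_append_iff hd_append)
  next
    case False
    then show ?thesis using xs step(2)
      by (intro exI[of _ "xs @ [z]"]) (auto simp: successively_append_iff)
  qed
qed

lemma successively_restrict:
  "successively (\<lambda>u v. u \<in> S \<and> v \<in> S \<and> P u v) xs \<Longrightarrow> xs \<noteq> [] \<Longrightarrow> hd xs \<in> S
    \<Longrightarrow> set xs \<subseteq> S \<and> successively P xs"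
  by (induction xs rule: induct_list012) auto

lemma successively_invariant:
  "successively R xs \<Longrightarrow> (\<And>x y. x \<in> set xs \<Longrightarrow> y \<in> set xs \<Longrightarrow> R x y \<Longrightarrow> x \<in> A \<longleftrightarrow> y \<in> A) \<Longrightarrow>
    set xs \<subseteq> A \<or> set xs \<inter> A = {}"
proof (induction xs rule: induct_list012)
  case (3 x y zs)
  then have "set (y # zs) \<subseteq> A \<or> set (y # zs) \<inter> A = {}" by simp
  moreover have "x \<in> A \<longleftrightarrow> y \<in> A" using 3 by simp
  ultimately show ?case by auto
qed auto

lemma split_two:
  assumes "u \<in> set xs" "v \<in> set xs" "u \<noteq> v"
  obtains as bs cs where "xs = as @ u # bs @ v # cs" | as bs cs where "xs = as @ v # bs @ u # cs"
proof -
  obtain as bs where xs: "xs = as @ u # bs" using assms(1) by (meson split_list)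
  then have "v \<in> set as \<or> v \<in> set bs" using assms by auto
  then show ?thesis
  proof
    assume "v \<in> set as"
    then obtain a b where "as = a @ v # b" by (meson split_list)
    then show ?thesis using that(2)[of a b bs] xs by simp
  next
    assume "v \<in> set bs"
    then obtain a b where "bs = a @ v # b" by (meson split_list)
    then show ?thesis using that(1)[of as a b] xs by simp
  qed
qed

text \<open>The decomposed form of the hypothesis is the one in which \<open>cycle_detour\<close>
  presents two vertices of a cycle.\<close>

lemma sorted_wrtI_split:
  "(\<And>as u bs v cs. xs = as @ u # bs @ v # cs \<Longrightarrow> P u v) \<Longrightarrow> sorted_wrt P xs"
proof (induction xs)
  case (Cons x xs)
  have "P x y" if y: "y \<in> set xs" for y
  proof -
    obtain bs cs where "xs = bs @ y # cs" using y by (meson split_list)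
    then show ?thesis using Cons.prems[of "[]" x bs y cs] by simp
  qed
  moreover have "sorted_wrt P xs"
  proof (rule Cons.IH)
    fix as u bs v cs assume "xs = as @ u # bs @ v # cs"
    then show "P u v" using Cons.prems[of "x # as" u bs v cs] by simp
  qed
  ultimately show ?case by simp
qed simp

subsection \<open>Paths and connectivity in weighted graphs\<close>

locale weighted_graph =
  fixes E :: "'a set set" and w :: "'a set \<Rightarrow> real"
  assumes card_edge: "e \<in> E \<Longrightarrow> card e = 2"
    and weight_nonneg: "e \<in> E \<Longrightarrow> 0 \<le> w e"
begin

abbreviation ad :: "'a \<Rightarrow> 'a \<Rightarrow> bool" where
  "ad \<equiv> adj E"

text \<open>With 0 for non-adjacent pairs, degrees are plain sums over vertex sets, and
  \<open>w\<close> is read on edges only, where it is known to be nonnegative.\<close>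

definition wt :: "'a \<Rightarrow> 'a \<Rightarrow> real" where
  "wt u v = (if ad u v then w {u, v} else 0)"

fun path_weight :: "'a list \<Rightarrow> real" where
  "path_weight (x # y # zs) = wt x y + path_weight (y # zs)"
| "path_weight _ = 0"

definition path_in :: "'a set \<Rightarrow> 'a list \<Rightarrow> bool" where
  "path_in S xs \<longleftrightarrow> xs \<noteq> [] \<and> distinct xs \<and> set xs \<subseteq> S \<and> successively ad xs"

definition cycle_in :: "'a set \<Rightarrow> 'a list \<Rightarrow> bool" where
  "cycle_in S xs \<longleftrightarrow> path_in S xs \<and> 3 \<le> length xs \<and> ad (last xs) (hd xs)"

definition cycle_weight :: "'a list \<Rightarrow> real" where
  "cycle_weight xs = path_weight xs + wt (last xs) (hd xs)"

text \<open>
  Vertex sets stand for the subgraphs they induce. Connectivity is expressed by cuts: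
  \<open>closed_in K X\<close> holds for \<open>K \<subseteq> X\<close> iff \<open>K\<close> is a union of components of \<open>X\<close>.
\<close>
definition closed_in :: "'a set \<Rightarrow> 'a set \<Rightarrow> bool" where
  "closed_in K X \<longleftrightarrow> (\<forall>x\<in>K. \<forall>y\<in>X - K. \<not> ad x y)"

definition connected_in :: "'a set \<Rightarrow> bool" where
  "connected_in S \<longleftrightarrow> (\<forall>A\<subseteq>S. A \<noteq> {} \<longrightarrow> closed_in A S \<longrightarrow> A = S)"

definition attached :: "'a set \<Rightarrow> 'a \<Rightarrow> bool" where
  "attached K u \<longleftrightarrow> (\<exists>v\<in>K. ad v u)"

text \<open>
  The last conjunct says that each component of \<open>H - b\<close> has a neighbour in the terminal set \<open>U\<close>.
  When \<open>H\<close> is connected with all of \<open>U\<close> attached, this is 2-connectivity of \<open>H \<union> U\<close> once a cycle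
  through \<open>U\<close> is added.
\<close>
definition nonseparable :: "'a set \<Rightarrow> 'a set \<Rightarrow> bool" where
  "nonseparable H U \<longleftrightarrow> finite H \<and> H \<noteq> {} \<and> connected_in H \<and> H \<inter> U = {} \<and> (\<forall>u\<in>U. attached H u) \<and>
     (\<forall>b\<in>H. \<forall>K\<subseteq>H - {b}. K \<noteq> {} \<longrightarrow> closed_in K (H - {b}) \<longrightarrow> (\<exists>u\<in>U. attached K u))"

definition deg :: "'a \<Rightarrow> 'a set \<Rightarrow> real" where
  "deg v X = (\<Sum>u\<in>X. wt v u)"

section \<open>Weights, reversal and concatenation of paths\<close>

lemma ad_sym: "ad u v \<longleftrightarrow> ad v u"
  by (simp add: adj_def insert_commute)

lemma ad_irrefl [simp]: "\<not> ad u u"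
  using card_edge[of "{u}"] by (auto simp: adj_def)

lemma wt_sym: "wt u v = wt v u"
  by (simp add: wt_def ad_sym insert_commute)

lemma wt_nonneg [simp]: "0 \<le> wt u v"
  using weight_nonneg by (simp add: wt_def adj_def)

lemma wt_refl [simp]: "wt u u = 0"
  by (simp add: wt_def)

lemma path_weight_nonneg [simp]: "0 \<le> path_weight xs"
  by (induction xs rule: path_weight.induct) auto

lemma path_weight_split: "path_weight (xs @ y # zs) = path_weight (xs @ [y]) + path_weight (y # zs)"
  by (induction xs rule: path_weight.induct) auto

lemma path_weight_append:
  "xs \<noteq> [] \<Longrightarrow> ys \<noteq> [] \<Longrightarrow>
    path_weight (xs @ ys) = path_weight xs + wt (last xs) (hd ys) + path_weight ys"
  by (induction xs rule: path_weight.induct) (cases ys; auto)+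

lemma path_weight_snoc: "path_weight (xs @ [y, z]) = path_weight (xs @ [y]) + wt y z"
  using path_weight_split[of xs y "[z]"] by simp

lemma path_weight_rev [simp]: "path_weight (rev xs) = path_weight xs"
proof (induction xs rule: path_weight.induct)
  case (1 x y zs)
  then show ?case using path_weight_snoc[of "rev zs" y x] by (simp add: wt_sym)
qed auto

lemma successively_ad_rev [simp]: "successively ad (rev xs) \<longleftrightarrow> successively ad xs"
proof -
  have "(\<lambda>x y. ad y x) = ad" by (intro ext) (rule ad_sym)
  then show ?thesis by (simp only: successively_rev)
qed

lemma path_in_rev [simp]: "path_in S (rev xs) \<longleftrightarrow> path_in S xs"
  by (simp only: path_in_def successively_ad_rev rev_is_Nil_conv distinct_rev set_rev)

lemma path_in_append:
  "xs \<noteq> [] \<Longrightarrow> ys \<noteq> [] \<Longrightarrow> path_in S (xs @ ys) \<longleftrightarrow>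
    path_in S xs \<and> path_in S ys \<and> set xs \<inter> set ys = {} \<and> ad (last xs) (hd ys)"
  by (auto simp: path_in_def successively_append_iff)

lemma path_in_infix: "path_in S (as @ ys @ cs) \<Longrightarrow> ys \<noteq> [] \<Longrightarrow> path_in S ys"
  by (auto simp only: path_in_def successively_append_iff set_append distinct_append)

lemma path_in_mono: "path_in S xs \<Longrightarrow> S \<subseteq> T \<Longrightarrow> path_in T xs"
  by (auto simp: path_in_def)

section \<open>Cuts, components and connectedness\<close>

lemma connected_inD: "connected_in S \<Longrightarrow> closed_in A S \<Longrightarrow> A \<subseteq> S \<Longrightarrow> a \<in> A \<Longrightarrow> A = S"
  unfolding connected_in_def by blast

text \<open>The vertices reachable from \<open>u\<close> inside \<open>S\<close> form a closed set,
  hence all of \<open>S\<close>.\<close>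

lemma connected_in_rtrancl:
  assumes "connected_in S" "u \<in> S" "v \<in> S"
  shows "(u, v) \<in> {(x, y). x \<in> S \<and> y \<in> S \<and> ad x y}\<^sup>*"
proof -
  let ?r = "{(x, y). x \<in> S \<and> y \<in> S \<and> ad x y}"
  define A where "A = {v \<in> S. (u, v) \<in> ?r\<^sup>*}"
  have "closed_in A S"
    unfolding closed_in_def A_def by (auto intro: rtrancl.rtrancl_into_rtrancl)
  moreover have "u \<in> A" "A \<subseteq> S" using assms by (auto simp: A_def)
  ultimately have "A = S" using assms(1) unfolding connected_in_def by blast
  then show ?thesis using assms(3) by (auto simp: A_def)
qed

lemma connected_in_path:
  assumes "connected_in S" "u \<in> S" "v \<in> S"
  obtains xs where "path_in S xs" "hd xs = u" "last xs = v"
proof -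
  from rtrancl_distinct_path[OF connected_in_rtrancl[OF assms]] obtain xs
    where xs: "xs \<noteq> []" "hd xs = u" "last xs = v" "distinct xs"
      "successively (\<lambda>u v. (u, v) \<in> {(x, y). x \<in> S \<and> y \<in> S \<and> ad x y}) xs" by blast
  then have "set xs \<subseteq> S \<and> successively ad xs"
    using assms by (intro successively_restrict) auto
  then show ?thesis using that xs by (auto simp: path_in_def)
qed

text \<open>Closedness is transitive, so passing repeatedly to closed proper subsets ends in a
  connected one.\<close>

lemma exists_component:
  assumes "finite X" "X \<noteq> {}"
  obtains K where "K \<subseteq> X" "K \<noteq> {}" "closed_in K X" "connected_in K"
proof -
  have "\<exists>K\<subseteq>X. K \<noteq> {} \<and> closed_in K X \<and> connected_in K"
    using assms
  proof (induction "card X" arbitrary: X rule: less_induct)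
    case less
    show ?case
    proof (cases "connected_in X")
      case True
      then show ?thesis using less.prems by (intro exI[of _ X]) (auto simp: closed_in_def)
    next
      case False
      then obtain A where A: "A \<subseteq> X" "A \<noteq> {}" "closed_in A X" "A \<noteq> X"
        unfolding connected_in_def by blast
      then have "card A < card X" using less.prems by (simp add: psubset_card_mono psubset_eq)
      moreover have "finite A" using A less.prems finite_subset by blast
      ultimately obtain K where K: "K \<subseteq> A" "K \<noteq> {}" "closed_in K A" "connected_in K"
        using less.hyps[of A] A by auto
      moreover have "closed_in K X" using A K unfolding closed_in_def by blast
      ultimately show ?thesis using A by blast
    qed
  qed
  then show ?thesis using that by blast
qed

lemma connected_in_attached:
  assumes "connected_in H" "b \<in> H" "K \<subseteq> H - {b}" "K \<noteq> {}" "closed_in K (H - {b})"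
  shows "attached K b"
proof (rule ccontr)
  assume "\<not> attached K b"
  then have "closed_in K H" using assms unfolding closed_in_def attached_def by blast
  then show False using assms unfolding connected_in_def by blast
qed

lemma closed_in_sym: "closed_in K X \<Longrightarrow> K \<subseteq> X \<Longrightarrow> closed_in (X - K) X"
  unfolding closed_in_def using ad_sym by blast

text \<open>A nonempty closed part of \<open>H - K\<close> missing \<open>b\<close> would be closed
  in \<open>H\<close>; and of two complementary closed parts of \<open>H - K\<close>, one misses
  \<open>b\<close>.\<close>

lemma connected_in_remove_closed:
  assumes "connected_in H" "b \<in> H" "K \<subseteq> H - {b}" "closed_in K (H - {b})"
  shows "connected_in (H - K)"
proof -
  have *: False if A: "A \<subseteq> H - K" "A \<noteq> {}" "closed_in A (H - K)" "b \<notin> A" for A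
  proof -
    have "closed_in A H" using A assms(3,4) unfolding closed_in_def using ad_sym by blast
    then have "A = H" using A assms(1) unfolding connected_in_def by blast
    then show False using A assms(2) by blast
  qed
  show ?thesis unfolding connected_in_def
  proof (intro allI impI)
    fix A assume A: "A \<subseteq> H - K" "A \<noteq> {}" "closed_in A (H - K)"
    then have b: "b \<in> A" using * by blast
    show "A = H - K"
    proof (rule ccontr)
      assume "A \<noteq> H - K"
      then show False using *[of "H - K - A"] closed_in_sym[OF A(3,1)] b A(1) by blast
    qed
  qed
qed

lemma deg_mono_neutral:
  assumes "finite Y" "X \<subseteq> Y" "\<And>u. u \<in> Y - X \<Longrightarrow> \<not> ad v u"
  shows "deg v Y = deg v X"
  unfolding deg_def using assms by (intro sum.mono_neutral_right) (auto simp: wt_def)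

text \<open>Here \<open>b\<close> takes over the role of all terminals other than \<open>x\<close>.
  Within \<open>H\<close> and \<open>U\<close>, vertices of \<open>K\<close> have neighbours only in
  \<open>K\<close>, \<open>b\<close> and \<open>x\<close>, so degrees do not change.\<close>

lemma nonseparable_leaf:
  assumes g: "nonseparable H U" and b: "b \<in> H" and K: "K \<subseteq> H - {b}" "K \<noteq> {}" "closed_in K (H - {b})" "connected_in K"
    and U: "x \<in> U" "finite U" "\<And>u. u \<in> U - {x} \<Longrightarrow> \<not> attached K u"
  shows "nonseparable K {x, b}" "v \<in> K \<Longrightarrow> deg v (H \<union> U) = deg v (K \<union> {x, b})"
proof -
  have f: "finite H" "connected_in H" using g by (auto simp: nonseparable_def)
  have 1: "attached K b" using connected_in_attached[OF f(2) b K(1-3)] .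
  have 2: "attached K x" using g b K U unfolding nonseparable_def by blast
  \<comment> \<open>A part \<open>L\<close> that \<open>c\<close> separates from \<open>x\<close>
    and \<open>b\<close> would be closed in \<open>H - {c}\<close> and so attached to another
    terminal, which is impossible inside \<open>K\<close>.\<close>
  have 3: "\<exists>u\<in>{x, b}. attached L u" if c: "c \<in> K" "L \<subseteq> K - {c}" "L \<noteq> {}" "closed_in L (K - {c})" for c L
  proof (rule ccontr)
    assume n: "\<not> (\<exists>u\<in>{x, b}. attached L u)"
    then have "closed_in L (H - {c})"
      using c K unfolding closed_in_def attached_def by blast
    moreover have "c \<in> H" "L \<subseteq> H - {c}" using c K by auto
    ultimately obtain u where "u \<in> U" "attached L u" using g c(3) unfolding nonseparable_def by blast
    then show False using U(3)[of u] n c unfolding attached_def by blast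
  qed
  show "nonseparable K {x, b}" unfolding nonseparable_def
    using f K g U 1 2 3 finite_subset[of K H] by (auto simp: nonseparable_def)
  show "deg v (H \<union> U) = deg v (K \<union> {x, b})" if v: "v \<in> K"
    using that f U K b unfolding closed_in_def attached_def
    by (intro deg_mono_neutral) auto
qed

subsection \<open>Heavy paths between terminals\<close>

text \<open>Paths through \<open>H\<close> between terminals outside \<open>H\<close>; only the interior is recorded.\<close>
definition link :: "'a set \<Rightarrow> 'a \<Rightarrow> 'a list \<Rightarrow> 'a \<Rightarrow> bool" where
  "link H u ys v \<longleftrightarrow> path_in H ys \<and> ad u (hd ys) \<and> ad (last ys) v"

definition link_weight :: "'a \<Rightarrow> 'a list \<Rightarrow> 'a \<Rightarrow> real" where
  "link_weight u ys v = path_weight (u # ys @ [v])"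

lemma link_rev: "link H u ys v \<Longrightarrow> link H v (rev ys) u"
  using ad_sym by (auto simp: link_def hd_rev last_rev)

lemma link_weight_rev: "link_weight v (rev ys) u = link_weight u ys v"
  using path_weight_rev[of "u # ys @ [v]"] by (simp add: link_weight_def del: path_weight_rev)

text \<open>From \<open>b\<close> the path goes on inside \<open>H - K\<close>, which is connected,
  to a neighbour of \<open>y\<close>; staying outside \<open>K\<close> keeps it disjoint from
  \<open>ys\<close>.\<close>

lemma leaf_link:
  assumes H: "connected_in H" "b \<in> H" "K \<subseteq> H - {b}" "closed_in K (H - {b})"
    and y: "attached H y" "\<not> attached K y" and l: "link K x ys b"
  shows "\<exists>zs. link H x zs y \<and> link_weight x ys b \<le> link_weight x zs y"
proof -
  obtain v where v: "v \<in> H - K" "ad v y" using y unfolding attached_def by blast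
  have "connected_in (H - K)" using connected_in_remove_closed H by blast
  then obtain zs where zs: "path_in (H - K) zs" "hd zs = b" "last zs = v"
    using connected_in_path v H by (metis DiffD2 DiffI insertI1 subsetD)
  have ne: "zs \<noteq> []" "ys \<noteq> []" using zs l by (auto simp: path_in_def link_def)
  have "link H x (ys @ zs) y"
  proof -
    have "path_in H ys" "path_in H zs" "set ys \<inter> set zs = {}"
      using l zs(1) H(3) by (auto simp: link_def path_in_def)
    then show ?thesis using l zs v ne by (auto simp: link_def path_in_append)
  qed
  moreover have "link_weight x ys b \<le> link_weight x (ys @ zs) y"
  proof -
    obtain zt where zt: "zs = b # zt" using zs ne by (cases zs) auto
    show ?thesis unfolding link_weight_def zt
      using path_weight_split[of "x # ys" b "zt @ [y]"] by simp
  qed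
  ultimately show ?thesis by blast
qed

lemma heaviest_neighbour:
  assumes "finite H" "attached H x"
  obtains x' where "x' \<in> H" "ad x x'" "\<And>v. v \<in> H \<Longrightarrow> wt v x \<le> wt x x'"
proof -
  let ?N = "{v \<in> H. ad x v}"
  have "?N \<noteq> {}" "finite ?N" using assms ad_sym by (auto simp: attached_def)
  then have "Max (wt x ` ?N) \<in> wt x ` ?N" "\<And>v. v \<in> ?N \<Longrightarrow> wt x v \<le> Max (wt x ` ?N)" by auto
  then obtain x' where x': "x' \<in> ?N" "\<And>v. v \<in> ?N \<Longrightarrow> wt x v \<le> wt x x'" by auto
  have "wt v x \<le> wt x x'" if "v \<in> H" for v
    using x'(2)[of v] that wt_sym[of v x] ad_sym[of v x] wt_nonneg[of x x'] by (cases "ad x v") (auto simp: wt_def)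
  then show ?thesis using that x' by blast
qed

text \<open>
  By induction on \<open>H\<close>: if some component \<open>K\<close> of some \<open>H - b\<close> is not attached to \<open>y\<close>, a heavy path
  from \<open>x\<close> to \<open>b\<close> through \<open>K\<close> extends to \<open>y\<close>. Otherwise go from \<open>x\<close> to its heaviest neighbour
  \<open>x'\<close> and continue in a component of \<open>H - x'\<close>; forgetting \<open>x\<close> costs each degree at most \<open>wt x x'\<close>.
\<close>
lemma heavy_link:
  assumes "nonseparable H {x, y}" "x \<noteq> y" "\<And>v. v \<in> H \<Longrightarrow> d \<le> deg v (H \<union> {x, y})"
  shows "\<exists>ys. link H x ys y \<and> d \<le> link_weight x ys y"
  using assms
proof (induction "card H" arbitrary: H x y d rule: less_induct)
  case less
  note g = less.prems(1)
  have H: "finite H" "H \<noteq> {}" "connected_in H" "H \<inter> {x, y} = {}" "attached H x" "attached H y"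
    using g by (auto simp: nonseparable_def)
  show ?case
  proof (cases "\<exists>b\<in>H. \<exists>K\<subseteq>H - {b}. K \<noteq> {} \<and> closed_in K (H - {b}) \<and> \<not> attached K y")
    case True
    then obtain b K' where b: "b \<in> H" "K' \<subseteq> H - {b}" "K' \<noteq> {}" "closed_in K' (H - {b})" "\<not> attached K' y"
      by blast
    obtain K where K: "K \<subseteq> K'" "K \<noteq> {}" "closed_in K K'" "connected_in K"
      using exists_component[of K'] b H finite_subset by (metis Diff_subset subset_trans)
    have K2: "K \<subseteq> H - {b}" "closed_in K (H - {b})" "\<not> attached K y"
      using b K unfolding closed_in_def attached_def by blast+
    have gK: "nonseparable K {x, b}" "\<And>v. v \<in> K \<Longrightarrow> deg v (H \<union> {x, y}) = deg v (K \<union> {x, b})"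
      using nonseparable_leaf[OF g b(1) K2(1) K(2) K2(2) K(4), of x] K2 by auto
    have "card K < card H" using K2 b H by (intro psubset_card_mono) auto
    moreover have "x \<noteq> b" using b H by auto
    ultimately obtain ys where "link K x ys b" "d \<le> link_weight x ys b"
      using less.hyps[of K x b d] gK less.prems(3) K2 by force
    then show ?thesis
      using leaf_link[OF H(3) b(1) K2(1,2) H(6) K2(3)] by fastforce
  next
    case False
    obtain x' where x': "x' \<in> H" "ad x x'" "\<And>v. v \<in> H \<Longrightarrow> wt v x \<le> wt x x'"
      using heaviest_neighbour H by metis
    show ?thesis
    proof (cases "H = {x'}")
      case True
      have "link H x [x'] y" using x' H True by (auto simp: link_def path_in_def attached_def)
      \<comment> \<open>This link weighs \<open>wt x x' + wt x' y\<close>, which is the degree of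
        \<open>x'\<close>.\<close>
      moreover have "d \<le> link_weight x [x'] y"
        using less.prems(2) less.prems(3)[of x'] H True by (auto simp: link_weight_def deg_def wt_sym)
      ultimately show ?thesis by blast
    next
      case ne: False
      then obtain H1 where H1: "H1 \<subseteq> H - {x'}" "H1 \<noteq> {}" "closed_in H1 (H - {x'})" "connected_in H1"
        using exists_component[of "H - {x'}"] H x' by blast
      have a: "attached H1 x'" "attached H1 y" using connected_in_attached[OF H(3) x'(1) H1(1-3)] False x' H1 by blast+
      \<comment> \<open>Although \<open>x\<close> is no longer a terminal, a part \<open>L\<close>
        missing \<open>x'\<close> and \<open>y\<close> would be closed in some
        \<open>H - {c}\<close> without being attached to \<open>y\<close>, which the present case
        excludes.\<close>
      have "\<exists>u\<in>{x', y}. attached L u" if c: "c \<in> H1" "L \<subseteq> H1 - {c}" "L \<noteq> {}" "closed_in L (H1 - {c})" for c L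
      proof (rule ccontr)
        assume n: "\<not> (\<exists>u\<in>{x', y}. attached L u)"
        then have "closed_in L (H - {c})"
          using c H1 unfolding closed_in_def attached_def by blast
        moreover have "c \<in> H" "L \<subseteq> H - {c}" using c H1 by auto
        ultimately show False using False n c(3) by blast
      qed
      then have g1: "nonseparable H1 {x', y}"
        using H H1 a finite_subset[of H1 H] unfolding nonseparable_def by auto
      have "d - wt x x' \<le> deg v (H1 \<union> {x', y})" if v: "v \<in> H1" for v
      proof -
        have "deg v (H \<union> {x, y}) = wt v x + deg v (H \<union> {y})"
          using H less.prems(2) unfolding deg_def by (simp add: insert_commute)
        moreover have "deg v (H \<union> {y}) = deg v (H1 \<union> {x', y})"
          using v H H1 x' unfolding closed_in_def by (intro deg_mono_neutral) auto
        ultimately show ?thesis using less.prems(3)[of v] x'(3)[of v] v H1 by fastforce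
      qed
      moreover have "card H1 < card H" using H1 H x' by (intro psubset_card_mono) auto
      moreover have "x' \<noteq> y" using x' H by auto
      ultimately obtain ys where ys: "link H1 x' ys y" "d - wt x x' \<le> link_weight x' ys y"
        using less.hyps[OF _ g1] by blast
      have "link H x (x' # ys) y"
        using ys H1 x' by (auto simp: link_def path_in_def successively_Cons)
      moreover have "d \<le> link_weight x (x' # ys) y"
        using ys by (simp add: link_weight_def)
      ultimately show ?thesis by blast
    qed
  qed
qed

text \<open>A path from \<open>x'\<close> is followed until it first meets \<open>ys\<close>, at
  \<open>q\<close>. The legs from \<open>u\<close> and \<open>v\<close> to \<open>q\<close> together
  use \<open>ys\<close> once, and both continue from \<open>q\<close> to \<open>x\<close>, so the
  edge at \<open>x\<close> is counted twice.\<close>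

lemma tripod:
  assumes H: "connected_in H" and l: "link H u ys v" and x': "x' \<in> H" "ad x x'"
  shows "\<exists>as bs. link H u as x \<and> link H v bs x \<and>
    link_weight u ys v + 2 * wt x x' \<le> link_weight u as x + link_weight v bs x"
proof -
  have "ys \<noteq> []" "set ys \<subseteq> H" using l by (auto simp: link_def path_in_def)
  then have "hd ys \<in> H" by (meson hd_in_set subsetD)
  then obtain zs where zs: "path_in H zs" "hd zs = x'" "last zs = hd ys"
    by (rule connected_in_path[OF H x'(1)])
  then have "last zs \<in> set zs" "last zs \<in> set ys"
    using \<open>ys \<noteq> []\<close> by (metis path_in_def last_in_set, simp)
  then have "\<exists>z\<in>set zs. z \<in> set ys" by blast
  then obtain ps q rs where q: "zs = ps @ q # rs" "q \<in> set ys" "\<forall>p\<in>set ps. p \<notin> set ys"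
    using split_list_first_prop[of zs "\<lambda>z. z \<in> set ys"] by blast
  obtain as bs where ys: "ys = as @ q # bs" using q(2) by (meson split_list)
  have ps: "path_in H (ps @ [q])" "hd (ps @ [q]) = x'"
    using zs q by (auto simp: path_in_def successively_append_iff hd_append)
  \<comment> \<open>The ends are kept general so that the reversal of \<open>ys\<close> yields the
    leg from \<open>v\<close>.\<close>
  have 1: "link H u (as @ q # rev ps) x" if "link H u (as @ q # bs) v'" "set ps \<inter> set as = {}"
    for u v' as bs
  proof -
    have "path_in H (rev (ps @ [q]))" using ps by (simp only: path_in_rev)
    then have "path_in H (q # rev ps)" by simp
    moreover have "last (q # rev ps) = x'" using ps(2) by (cases ps) auto
    moreover have "path_in H as" "ad (last as) q" if "as \<noteq> []"
      using \<open>link H u (as @ q # bs) v'\<close> that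
      by (auto simp: link_def path_in_def successively_append_iff)
    moreover have "q \<notin> set as" using that by (auto simp: link_def path_in_def)
    ultimately show ?thesis using that x'(2) ad_sym
      by (cases "as = []") (auto simp: link_def path_in_append)
  qed
  have 2: "link_weight u (as @ q # rev ps) x \<ge> path_weight (u # as @ [q]) + wt x x'" for u as
  proof -
    have "path_weight (q # rev ps @ [x]) = path_weight (x # ps @ [q])"
      using path_weight_rev[of "x # ps @ [q]"] by (simp del: path_weight_rev)
    moreover have "path_weight (x # ps @ [q]) \<ge> wt x x'"
      using ps(2) by (cases ps) auto
    ultimately show ?thesis unfolding link_weight_def
      using path_weight_split[of "u # as" q "rev ps @ [x]"] by simp
  qed
  have "link H u (as @ q # rev ps) x" using 1 l ys q(3) by fastforce
  moreover have "link H v (rev bs @ q # rev ps) x"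
    using 1[of v "rev bs" "rev as" u] link_rev[OF l] ys q(3) by fastforce
  moreover have "link_weight u ys v = path_weight (u # as @ [q]) + path_weight (v # rev bs @ [q])"
    using path_weight_split[of "u # as" q "bs @ [v]"] path_weight_rev[of "q # bs @ [v]"]
    by (simp add: link_weight_def ys del: path_weight_rev)
  ultimately show ?thesis using 2[of u as] 2[of v "rev bs"] by fastforce
qed

text \<open>
  The terminals are placed on a circle of length \<open>L\<close> at the positions \<open>s\<close>; up to \<open>\<delta>\<close>, paths through
  \<open>H\<close> are no heavier than either arc between their ends. Removing the last terminal \<open>x\<close> with heaviest
  neighbour \<open>x'\<close> lowers \<open>d\<close> by at most \<open>m = wt x x'\<close>, and by \<open>tripod\<close> the remaining terminals
  satisfy the hypothesis on a circle of length \<open>L - 2 m + \<delta>\<close>, with the positions unchanged.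
\<close>
lemma degree_bound:
  fixes d L \<delta> :: real
  assumes "nonseparable H (set us)" "distinct us" "2 \<le> length us" "0 \<le> \<delta>"
    and "\<And>v. v \<in> H \<Longrightarrow> d \<le> deg v (H \<union> set us)"
    and "sorted_wrt (\<lambda>u v. \<forall>ys. link H u ys v \<longrightarrow> link_weight u ys v \<le> s v - s u + \<delta> \<and>
      link_weight u ys v \<le> L - (s v - s u) + \<delta>) us"
  shows "2 * d \<le> L + length us * \<delta>"
  using assms
proof (induction us arbitrary: d L rule: rev_induct)
  case Nil
  then show ?case by simp
next
  case (snoc x vs)
  note g = snoc.prems(1)
  have H: "finite H" "H \<noteq> {}" "connected_in H" "H \<inter> set (vs @ [x]) = {}" "\<And>u. u \<in> set (vs @ [x]) \<Longrightarrow> attached H u"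
    using g by (auto simp: nonseparable_def)
  have xv: "link_weight u ys x \<le> s x - s u + \<delta>" "link_weight u ys x \<le> L - (s x - s u) + \<delta>"
    if "u \<in> set vs" "link H u ys x" for u ys
    using snoc.prems(6) that by (auto simp: sorted_wrt_append)
  \<comment> \<open>Adding the bounds for the two arcs between \<open>u\<close> and \<open>x\<close>
    cancels the positions and gives \<open>2 * d\<close> at most
    \<open>L + 2 * \<delta>\<close>.\<close>
  have one: ?case if "u \<in> set vs" "link H u ys x" "d \<le> link_weight u ys x" for u ys
  proof -
    have "2 * \<delta> \<le> length (vs @ [x]) * \<delta>"
      using snoc.prems(3,4) by (intro mult_right_mono) auto
    then show ?thesis using xv[OF that(1,2)] that(3) by linarith
  qed
  \<comment> \<open>In the first case dropping \<open>x\<close> would destroy nonseparability: some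
    part of \<open>H - {b}\<close> reaches no other terminal.\<close>
  consider (leaf) "\<exists>b\<in>H. \<exists>K\<subseteq>H - {b}. K \<noteq> {} \<and> closed_in K (H - {b}) \<and> (\<forall>u\<in>set vs. \<not> attached K u)"
    | (two) "length vs = 1"
    | (more) "2 \<le> length vs"
        "\<forall>b\<in>H. \<forall>K\<subseteq>H - {b}. K \<noteq> {} \<longrightarrow> closed_in K (H - {b}) \<longrightarrow> (\<exists>u\<in>set vs. attached K u)"
    using snoc.prems(3) by fastforce
  then show ?case
  proof cases
    case leaf
    then obtain b K' where b: "b \<in> H" "K' \<subseteq> H - {b}" "K' \<noteq> {}" "closed_in K' (H - {b})"
      "\<forall>u\<in>set vs. \<not> attached K' u"
      by blast
    obtain K where K: "K \<subseteq> K'" "K \<noteq> {}" "closed_in K K'" "connected_in K"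
      using exists_component[of K'] b H finite_subset by (metis Diff_subset subset_trans)
    have K2: "K \<subseteq> H - {b}" "closed_in K (H - {b})" "\<forall>u\<in>set vs. \<not> attached K u"
      using b K unfolding closed_in_def attached_def by blast+
    have gK: "nonseparable K {x, b}" "\<And>v. v \<in> K \<Longrightarrow> deg v (H \<union> set (vs @ [x])) = deg v (K \<union> {x, b})"
      using nonseparable_leaf[OF g b(1) K2(1) K(2) K2(2) K(4), of x] K2(3) by auto
    have "d \<le> deg v (K \<union> {x, b})" if "v \<in> K" for v
      using gK(2)[OF that] snoc.prems(5)[of v] that K2(1) by auto
    moreover have "x \<noteq> b" using b H by auto
    ultimately obtain ys where ys: "link K x ys b" "d \<le> link_weight x ys b"
      using heavy_link[OF gK(1)] by blast
    \<comment> \<open>Any other terminal will do as the second end of the heavy link.\<close>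
    obtain u where u: "u \<in> set vs" using snoc.prems(3) by (cases vs) auto
    then obtain zs where zs: "link H x zs u" "link_weight x ys b \<le> link_weight x zs u"
      using leaf_link[OF H(3) b(1) K2(1,2) _ _ ys(1), of u] H(5) K2(3) by auto
    show ?thesis using one[OF u link_rev[OF zs(1)]] zs ys by (simp add: link_weight_rev)
  next
    case two
    then obtain u where vs: "vs = [u]" by (cases vs) auto
    then have "nonseparable H {u, x}" "u \<noteq> x" "\<And>v. v \<in> H \<Longrightarrow> d \<le> deg v (H \<union> {u, x})"
      using snoc.prems by auto
    then obtain ys where "link H u ys x" "d \<le> link_weight u ys x" using heavy_link by blast
    then show ?thesis using one vs by auto
  next
    case more
    obtain x' where x': "x' \<in> H" "ad x x'" "\<And>v. v \<in> H \<Longrightarrow> wt v x \<le> wt x x'"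
      using heaviest_neighbour[of H x] H by auto
    have g': "nonseparable H (set vs)" using g more(2) by (auto simp: nonseparable_def)
    have d': "d - wt x x' \<le> deg v (H \<union> set vs)" if "v \<in> H" for v
    proof -
      have "deg v (H \<union> set (vs @ [x])) = wt v x + deg v (H \<union> set vs)"
        using H snoc.prems(2) by (simp add: deg_def)
      then show ?thesis using snoc.prems(5)[OF that] x'(3)[OF that] by simp
    qed
    have "sorted_wrt (\<lambda>u v. \<forall>ys. link H u ys v \<longrightarrow> link_weight u ys v \<le> s v - s u + \<delta> \<and>
      link_weight u ys v \<le> L - (s v - s u) + \<delta>) vs"
      using snoc.prems(6) by (simp add: sorted_wrt_append)
    then have "sorted_wrt (\<lambda>u v. \<forall>ys. link H u ys v \<longrightarrow> link_weight u ys v \<le> s v - s u + \<delta> \<and>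
      link_weight u ys v \<le> (L - 2 * wt x x' + \<delta>) - (s v - s u) + \<delta>) vs"
    proof (rule sorted_wrt_mono_rel[rotated], intro allI impI conjI)
      fix u v ys
      assume uv: "u \<in> set vs" "v \<in> set vs" "link H u ys v"
        and *: "\<forall>ys. link H u ys v \<longrightarrow> link_weight u ys v \<le> s v - s u + \<delta> \<and>
          link_weight u ys v \<le> L - (s v - s u) + \<delta>"
      then show "link_weight u ys v \<le> s v - s u + \<delta>" by blast
      obtain as bs where "link H u as x" "link H v bs x"
        "link_weight u ys v + 2 * wt x x' \<le> link_weight u as x + link_weight v bs x"
        using tripod[OF H(3) uv(3) x'(1,2)] by blast
      \<comment> \<open>Using the bound for the outer arc at \<open>u\<close> and for the inner arc
        at \<open>v\<close>, the position of \<open>x\<close> cancels.\<close>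
      then show "link_weight u ys v \<le> (L - 2 * wt x x' + \<delta>) - (s v - s u) + \<delta>"
        using xv(2)[OF uv(1)] xv(1)[OF uv(2)] by fastforce
    qed
    then have "2 * (d - wt x x') \<le> (L - 2 * wt x x' + \<delta>) + length vs * \<delta>"
      using snoc.IH[OF g' _ more(1) snoc.prems(4) d'] snoc.prems(2) by auto
    then show ?thesis by (simp add: algebra_simps)
  qed
qed

subsection \<open>Paths from an edge to a cycle\<close>

text \<open>If \<open>K\<close> were attached to at most one vertex \<open>c\<close> of
  \<open>X\<close>, then \<open>K\<close> would be closed in \<open>S - {c}\<close>, which is
  connected and contains another vertex of \<open>X\<close>.\<close>

lemma two_attachments:
  assumes S: "\<And>c. c \<in> S \<Longrightarrow> connected_in (S - {c})" and X: "X \<subseteq> S" "a \<in> X" "b \<in> X" "a \<noteq> b"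
    and K: "K \<subseteq> S - X" "K \<noteq> {}" "closed_in K (S - X)"
  shows "\<exists>p\<in>X. \<exists>q\<in>X. p \<noteq> q \<and> attached K p \<and> attached K q"
proof -
  have *: "\<exists>q\<in>X. q \<noteq> c \<and> attached K q" if c: "c \<in> X" for c
  proof (rule ccontr)
    assume "\<not> (\<exists>q\<in>X. q \<noteq> c \<and> attached K q)"
    then have "closed_in K (S - {c})" using K unfolding closed_in_def attached_def by blast
    moreover have "K \<subseteq> S - {c}" "K \<noteq> S - {c}" using K c X by blast+
    ultimately show False using S[of c] K(2) c X unfolding connected_in_def by blast
  qed
  then show ?thesis using X by metis
qed

text \<open>The one-vertex list \<open>[s]\<close> qualifies when \<open>s\<close> is in
  \<open>C\<close>, so an edge with one end on \<open>C\<close> needs no separate treatment.\<close>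

definition path_to :: "'a set \<Rightarrow> 'a set \<Rightarrow> 'a list \<Rightarrow> bool" where
  "path_to C X P \<longleftrightarrow> path_in X P \<and> last P \<in> C \<and> set (butlast P) \<inter> C = {}"

definition disjoint_paths_to :: "'a set \<Rightarrow> 'a set \<Rightarrow> 'a \<Rightarrow> 'a \<Rightarrow> bool" where
  "disjoint_paths_to C X s t \<longleftrightarrow> (\<exists>P Q. path_to C X P \<and> path_to C X Q \<and> hd P = s \<and> hd Q = t \<and>
     set P \<inter> set Q = {})"

lemma disjoint_paths_to_sym: "disjoint_paths_to C X s t \<Longrightarrow> disjoint_paths_to C X t s"
  unfolding disjoint_paths_to_def by blast

lemma path_to_mono: "path_to C X P \<Longrightarrow> X \<subseteq> Y \<Longrightarrow> path_to C Y P"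
  by (auto simp: path_to_def intro: path_in_mono)

lemma disjoint_paths_to_mono:
  assumes "disjoint_paths_to C X s t" "X \<subseteq> Y"
  shows "disjoint_paths_to C Y s t"
proof -
  obtain P Q where "path_to C X P" "path_to C X Q" "hd P = s" "hd Q = t" "set P \<inter> set Q = {}"
    using assms(1) unfolding disjoint_paths_to_def by blast
  moreover from this have "path_to C Y P" "path_to C Y Q" using assms(2) path_to_mono by blast+
  ultimately show ?thesis unfolding disjoint_paths_to_def by blast
qed

lemma path_to_append:
  assumes "path_to C X P" "path_in Y R" "Y \<inter> X = {}" "C \<subseteq> X" "ad (last R) (hd P)"
  shows "path_to C (X \<union> Y) (R @ P)"
proof -
  have "P \<noteq> []" "R \<noteq> []" using assms by (auto simp: path_to_def path_in_def)
  moreover have "set P \<subseteq> X" "set R \<subseteq> Y" using assms by (auto simp: path_to_def path_in_def)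
  ultimately show ?thesis using assms
    by (auto simp: path_to_def path_in_append butlast_append intro: path_in_mono)
qed

text \<open>A vertex on the ear \<open>ys\<close> runs along it to \<open>p\<close> or
  \<open>q\<close> and continues in \<open>X\<close>. Two vertices on the ear run to opposite ends
  and continue along disjoint paths from \<open>p\<close> and \<open>q\<close>.\<close>

lemma disjoint_paths_extend:
  assumes l: "link K p ys q" and X: "C \<subseteq> X" "K \<inter> X = {}" "p \<in> X" "q \<in> X" "p \<noteq> q"
    and D: "\<And>s t. s \<in> X \<Longrightarrow> t \<in> X \<Longrightarrow> s \<noteq> t \<Longrightarrow> disjoint_paths_to C X s t"
    and st: "s \<in> X \<union> set ys" "t \<in> X \<union> set ys" "s \<noteq> t"
  shows "disjoint_paths_to C (X \<union> set ys) s t"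
proof -
  have XY: "set ys \<inter> X = {}" using l X by (auto simp: link_def path_in_def)
  have left: "path_to C (X \<union> set ys) (s # rev as @ P)"
    if "link K p ys' q" "ys' = as @ s # bs" "set ys' = set ys" "path_to C X P" "hd P = p" for s as bs P p q ys'
  proof -
    have "path_in (set ys) (as @ [s])" "ad p (hd (as @ [s]))"
      using that by (auto simp: link_def path_in_def successively_append_iff hd_append split: if_splits)
    then have "path_in (set ys) (rev (as @ [s]))" "ad (last (rev (as @ [s]))) p"
      by (simp_all only: path_in_rev last_rev ad_sym)
    then show ?thesis using path_to_append[of C X P "set ys" "rev (as @ [s])"] that XY X by simp
  qed
  have one': "disjoint_paths_to C (X \<union> set ys) s t"
    if l: "link K p ys' q" "set ys' = set ys" "s \<in> set ys" "p \<in> X" "t \<in> X" "t \<noteq> p" for s t p q ys'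
  proof -
    obtain as bs where s: "ys' = as @ s # bs" using l by (metis split_list)
    obtain P Q where "path_to C X P" "path_to C X Q" "hd P = p" "hd Q = t" "set P \<inter> set Q = {}"
      using D[of p t] l unfolding disjoint_paths_to_def by metis
    moreover from this have "path_to C (X \<union> set ys) Q" "set Q \<subseteq> X"
      by (auto simp: path_to_def intro: path_in_mono) (auto simp: path_in_def)
    ultimately show ?thesis
      using left[OF l(1) s l(2)] XY l(2) s unfolding disjoint_paths_to_def
      by (intro exI[of _ "s # rev as @ P"] exI[of _ Q]) auto
  qed
  \<comment> \<open>The vertex \<open>s\<close> runs to an end of the ear different from
    \<open>t\<close>; towards \<open>q\<close> this is the same argument on the reversed
    ear.\<close>
  have one: "disjoint_paths_to C (X \<union> set ys) s t" if "s \<in> set ys" "t \<in> X" for s t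
    using one'[OF l _ that(1) X(3) that(2)] one'[OF link_rev[OF l] _ that(1) X(4) that(2)] X(5)
    by (cases "t = p") auto
  have two: "disjoint_paths_to C (X \<union> set ys) s t" if ys: "ys = as @ s # bs @ t # cs" for s t as bs cs
  proof -
    obtain P Q where PQ: "path_to C X P" "path_to C X Q" "hd P = p" "hd Q = q" "set P \<inter> set Q = {}"
      using D[of p q] X unfolding disjoint_paths_to_def by metis
    have "path_to C (X \<union> set ys) (s # rev as @ P)"
      using left[OF l ys _ PQ(1,3)] by simp
    moreover have "path_to C (X \<union> set ys) (t # cs @ Q)"
    proof -
      have "rev ys = rev cs @ t # (rev bs @ s # rev as)" "set (rev ys) = set ys" by (simp_all only: ys) auto
      then show ?thesis
        using left[OF link_rev[OF l], of "rev cs" t "rev bs @ s # rev as" Q] PQ(2,4) by (metis rev_rev_ident)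
    qed
    moreover have "set P \<subseteq> X" "set Q \<subseteq> X" using PQ by (auto simp: path_to_def path_in_def)
    moreover have "distinct ys" using l by (auto simp: link_def path_in_def)
    ultimately show ?thesis unfolding disjoint_paths_to_def using PQ(5) XY ys
      by (intro exI[of _ "s # rev as @ P"] exI[of _ "t # cs @ Q"]) auto
  qed
  show ?thesis
  proof (cases "s \<in> X"; cases "t \<in> X")
    assume "s \<in> X" "t \<in> X"
    then show ?thesis using D st disjoint_paths_to_mono by blast
  next
    assume "s \<in> X" "t \<notin> X"
    then show ?thesis using one st disjoint_paths_to_sym by blast
  next
    assume "s \<notin> X" "t \<in> X"
    then show ?thesis using one st by blast
  next
    assume "s \<notin> X" "t \<notin> X"
    then have "s \<in> set ys" "t \<in> set ys" using st by auto
    then obtain as bs where ys: "ys = as @ s # bs" "t \<in> set as \<or> t \<in> set bs"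
      using st(3) by (metis split_list set_append UnE set_ConsD)
    then show ?thesis
    proof (elim disjE)
      assume "t \<in> set as"
      then obtain a1 a2 where "as = a1 @ t # a2" by (meson split_list)
      then show ?thesis using two[of a1 t a2 s bs] ys disjoint_paths_to_sym by simp
    next
      assume "t \<in> set bs"
      then obtain a1 a2 where "bs = a1 @ t # a2" by (meson split_list)
      then show ?thesis using two[of as s a1 t a2] ys by simp
    qed
  qed
qed

text \<open>
  This case of Menger's theorem is proved by growing \<open>X\<close> from \<open>C\<close> to \<open>S\<close> by ears.
\<close>
lemma exist_disjoint_paths:
  assumes "finite S" "\<And>c. c \<in> S \<Longrightarrow> connected_in (S - {c})" "C \<subseteq> S" "a \<in> C" "b \<in> C" "a \<noteq> b"
    "s \<in> S" "t \<in> S" "s \<noteq> t"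
  shows "disjoint_paths_to C S s t"
proof -
  have "\<forall>s\<in>S. \<forall>t\<in>S. s \<noteq> t \<longrightarrow> disjoint_paths_to C S s t"
    if "C \<subseteq> X" "X \<subseteq> S" "\<forall>s\<in>X. \<forall>t\<in>X. s \<noteq> t \<longrightarrow> disjoint_paths_to C X s t" for X
    using that
  proof (induction "card (S - X)" arbitrary: X rule: less_induct)
    case less
    show ?case
    proof (cases "X = S")
      case True
      then show ?thesis using less.prems by blast
    next
      case False
      then obtain K where K: "K \<subseteq> S - X" "K \<noteq> {}" "closed_in K (S - X)" "connected_in K"
        using exists_component[of "S - X"] assms(1) less.prems by blast
      obtain p q where pq: "p \<in> X" "q \<in> X" "p \<noteq> q" "attached K p" "attached K q"
        using two_attachments[OF assms(2) less.prems(2), of a b K] assms less.prems(1) K by blast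
      obtain k k' where k: "k \<in> K" "k' \<in> K" "ad p k" "ad k' q"
        using pq ad_sym unfolding attached_def by blast
      then obtain ys where ys: "path_in K ys" "hd ys = k" "last ys = k'" using connected_in_path K by metis
      then have l: "link K p ys q" using k by (simp add: link_def)
      have ne: "set ys \<subseteq> S - X" "hd ys \<in> set ys" using ys K by (auto simp: path_in_def)
      have "card (S - (X \<union> set ys)) < card (S - X)"
        using assms(1) ne by (intro psubset_card_mono) (blast, fast)
      moreover have "\<forall>s\<in>X \<union> set ys. \<forall>t\<in>X \<union> set ys. s \<noteq> t \<longrightarrow> disjoint_paths_to C (X \<union> set ys) s t"
        using disjoint_paths_extend[OF l less.prems(1) _ pq(1-3)] less.prems(3) K(1) by blast
      ultimately show ?thesis using less.hyps[of "X \<union> set ys"] less.prems ne by blast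
    qed
  qed
  \<comment> \<open>The growth starts at \<open>X = C\<close>, where both paths are single
    vertices.\<close>
  moreover have "disjoint_paths_to C C s t" if "s \<in> C" "t \<in> C" "s \<noteq> t" for s t
    unfolding disjoint_paths_to_def path_to_def using that
    by (intro exI[of _ "[s]"] exI[of _ "[t]"]) (auto simp: path_in_def)
  ultimately show ?thesis using assms(3,7-9) by blast
qed

text \<open>Disjoint paths from the two ends of the edge to \<open>C\<close> are joined by the edge
  itself.\<close>

lemma link_through_edge:
  assumes S: "finite S" "\<And>c. c \<in> S \<Longrightarrow> connected_in (S - {c})" and C: "C \<subseteq> S" "x \<in> C" "y \<in> C" "x \<noteq> y"
    and e: "a \<in> S" "b \<in> S" "ad a b" "\<not> {a, b} \<subseteq> C"
  obtains u v ys where "u \<in> C" "v \<in> C" "u \<noteq> v" "link (S - C) u ys v" "w {a, b} \<le> link_weight u ys v"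
proof -
  have "a \<noteq> b" using e by auto
  then obtain P Q where PQ: "path_to C S P" "path_to C S Q" "hd P = a" "hd Q = b" "set P \<inter> set Q = {}"
    using exist_disjoint_paths[OF S C e(1,2)] unfolding disjoint_paths_to_def by blast
  have ne: "P \<noteq> []" "Q \<noteq> []" using PQ by (auto simp: path_to_def path_in_def)
  define u v ys where "u = last P" "v = last Q" "ys = rev (butlast P) @ butlast Q"
  have eq: "rev P @ Q = u # ys @ [v]"
  proof -
    have "P = butlast P @ [u]" "Q = butlast Q @ [v]" using ne by (simp_all add: u_v_ys_def)
    then show ?thesis
      by (metis u_v_ys_def(3) append_Cons append_Nil append_assoc rev.simps rev_append rev_rev_ident)
  qed
  have "path_in S (rev P @ Q)"
    using PQ ne e(3) by (auto simp: path_in_append path_to_def last_rev)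
  then have p: "path_in S (u # ys @ [v])" by (simp only: eq)
  have uv: "u \<in> C" "v \<in> C" "set ys \<inter> C = {}"
    using PQ by (auto simp: u_v_ys_def path_to_def)
  \<comment> \<open>The link has an inner vertex because one end of the edge lies off
    \<open>C\<close>.\<close>
  have "ys \<noteq> []"
  proof
    assume "ys = []"
    then have "set (rev P @ Q) \<subseteq> C" using uv eq by simp
    moreover have "a \<in> set P" "b \<in> set Q" using PQ(3,4) ne by auto
    ultimately show False using e(4) by auto
  qed
  then have "link (S - C) u ys v" using p uv(3)
    by (auto simp: link_def path_in_def successively_append_iff successively_Cons hd_append)
  moreover have "w {a, b} \<le> link_weight u ys v"
  proof -
    obtain P' Q' where "P = a # P'" "Q = b # Q'" using PQ ne by (metis list.exhaust_sel)
    then have "link_weight u ys v = path_weight (rev P' @ a # b # Q')"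
      using eq by (simp add: link_weight_def)
    also have "\<dots> \<ge> wt a b" using path_weight_split[of "rev P'" a "b # Q'"] by simp
    finally show ?thesis using e(3) by (simp add: wt_def)
  qed
  moreover have "u \<noteq> v" using p by (auto simp: path_in_def)
  ultimately show ?thesis using that uv by blast
qed

subsection \<open>Edges on cycles\<close>

lemma cycle_in_rotate: "cycle_in S (as @ bs) \<Longrightarrow> cycle_in S (bs @ as)"
  by (cases "as = []"; cases "bs = []") (auto simp: cycle_in_def path_in_append)

lemma cycle_in_mono: "cycle_in S xs \<Longrightarrow> S \<subseteq> T \<Longrightarrow> cycle_in T xs"
  by (auto simp: cycle_in_def intro: path_in_mono)

text \<open>Cycles may be rotated and reversed, so the given edge can be taken as the closing
  one.\<close>

definition on_cycle :: "'a set \<Rightarrow> 'a set \<Rightarrow> bool" where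
  "on_cycle S e \<longleftrightarrow> (\<exists>xs. cycle_in S xs \<and> e = {hd xs, last xs})"

definition edges :: "'a set \<Rightarrow> 'a set set" where
  "edges S = {e \<in> E. e \<subseteq> S}"

text \<open>A bridge is treated as half of a closed walk of weight \<open>M\<close> that traverses
  it twice.\<close>

definition edge_value :: "real \<Rightarrow> 'a set \<Rightarrow> 'a set \<Rightarrow> real" where
  "edge_value M S e = (if on_cycle S e then w e else M / 2)"

lemma on_cycle_mono: "on_cycle S e \<Longrightarrow> S \<subseteq> T \<Longrightarrow> on_cycle T e"
  unfolding on_cycle_def using cycle_in_mono by blast

lemma finite_edges: "finite S \<Longrightarrow> finite (edges S)"
  by (rule finite_subset[of _ "Pow S"]) (auto simp: edges_def)

lemma edgesE:
  assumes "e \<in> edges S"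
  obtains a b where "e = {a, b}" "a \<noteq> b" "a \<in> S" "b \<in> S" "ad a b"
  using assms card_edge by (force simp: edges_def card_2_iff adj_def)

lemma sum_edges_remove:
  assumes "finite S" "z \<in> S"
  shows "sum w (edges S) = deg z S + sum w (edges (S - {z}))"
proof -
  let ?N = "{u \<in> S. ad z u}"
  have "edges S = (\<lambda>u. {z, u}) ` ?N \<union> edges (S - {z})"
  proof (intro equalityI subsetI)
    fix e assume "e \<in> edges S"
    then show "e \<in> (\<lambda>u. {z, u}) ` ?N \<union> edges (S - {z})"
      by (rule edgesE) (use \<open>e \<in> edges S\<close> in \<open>auto simp: edges_def image_iff ad_sym doubleton_eq_iff\<close>)
  next
    fix e assume "e \<in> (\<lambda>u. {z, u}) ` ?N \<union> edges (S - {z})"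
    then show "e \<in> edges S" using assms by (auto simp: edges_def adj_def)
  qed
  moreover have "(\<lambda>u. {z, u}) ` ?N \<inter> edges (S - {z}) = {}" by (auto simp: edges_def)
  moreover have "sum w ((\<lambda>u. {z, u}) ` ?N) = deg z S"
  proof -
    have "inj_on (\<lambda>u. {z, u}) ?N" by (auto simp: inj_on_def doubleton_eq_iff)
    then have "sum w ((\<lambda>u. {z, u}) ` ?N) = (\<Sum>u\<in>?N. w {z, u})" by (simp add: sum.reindex)
    also have "\<dots> = deg z S"
      unfolding deg_def wt_def using assms(1) by (simp add: sum.If_cases Int_def)
    finally show ?thesis .
  qed
  ultimately show ?thesis
    using assms finite_edges[of "S - {z}"] by (simp add: sum.union_disjoint)
qed

lemma path_closed:
  assumes "successively ad xs" "set xs \<subseteq> X" "closed_in K X"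
  shows "set xs \<subseteq> K \<or> set xs \<inter> K = {}"
  using assms(1)
proof (rule successively_invariant)
  fix x y assume "x \<in> set xs" "y \<in> set xs" "ad x y"
  then show "x \<in> K \<longleftrightarrow> y \<in> K" using assms(2,3) ad_sym[of x y] unfolding closed_in_def by blast
qed

text \<open>Without \<open>c\<close>, the cycle is still connected and so lies on one side of the
  cut.\<close>

lemma cycle_cut_vertex:
  assumes "cycle_in S xs" "closed_in K (S - {c})"
  shows "set xs \<subseteq> insert c K \<or> set xs \<inter> (K - {c}) = {}"
proof (cases "c \<in> set xs")
  case True
  then obtain as bs where xs: "xs = as @ c # bs" by (meson split_list)
  have "cycle_in S ([c] @ (bs @ as))" using cycle_in_rotate[of S as "c # bs"] assms(1) xs by simp
  then have "successively ad (bs @ as)" "set (bs @ as) \<subseteq> S - {c}"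
    by (auto simp: cycle_in_def path_in_def successively_append_iff successively_Cons)
  from path_closed[OF this assms(2)] show ?thesis using xs by auto
next
  case False
  then have "successively ad xs" "set xs \<subseteq> S - {c}"
    using assms(1) by (auto simp: cycle_in_def path_in_def)
  from path_closed[OF this assms(2)] show ?thesis by blast
qed

lemma cycle_chord:
  assumes "cycle_in S (as @ u # bs @ v # cs)" "ad u v" "bs \<noteq> []"
  shows "cycle_in S (u # bs @ [v])"
proof -
  have "path_in S (as @ (u # bs @ [v]) @ cs)" using assms(1) by (simp add: cycle_in_def)
  then have "path_in S (u # bs @ [v])"
    by (auto simp only: path_in_def successively_append_iff set_append distinct_append)
  moreover have "3 \<le> length (u # bs @ [v])" using assms(3) by (cases bs) auto
  ultimately show ?thesis using assms(2) ad_sym[of u v] by (simp add: cycle_in_def)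
qed

text \<open>Consecutive vertices are rotated to the two ends of the list; otherwise the segment
  between \<open>u\<close> and \<open>v\<close> is closed by the edge. Either way no vertex outside
  \<open>xs\<close> is used.\<close>

lemma on_cycle_vertices:
  assumes c: "cycle_in S xs" and uv: "u \<in> set xs" "v \<in> set xs" "ad u v"
  shows "on_cycle (set xs) {u, v}"
proof -
  have *: "on_cycle (set xs) {u, v}" if xs: "xs = as @ u # bs @ v # cs" and a: "ad u v" for u v as bs cs
  proof -
    have c': "cycle_in (set xs) xs" using c by (auto simp: cycle_in_def path_in_def)
    show ?thesis
    proof (cases "bs = []")
      case False
      then have "cycle_in (set xs) (u # bs @ [v])" using cycle_chord[OF _ a] c' xs by blast
      then show ?thesis unfolding on_cycle_def by (intro exI[of _ "u # bs @ [v]"]) auto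
    next
      case True
      then have "cycle_in (set xs) ((as @ [u]) @ (v # cs))" using c' xs by simp
      then have "cycle_in (set xs) ((v # cs) @ (as @ [u]))" by (rule cycle_in_rotate)
      then show ?thesis unfolding on_cycle_def
        by (intro exI[of _ "(v # cs) @ (as @ [u])"]) auto
    qed
  qed
  have "u \<noteq> v" using uv by auto
  with uv(1,2) show ?thesis
  proof (rule split_two)
    fix as bs cs assume "xs = as @ u # bs @ v # cs"
    then show ?thesis using * uv(3) by blast
  next
    fix as bs cs assume "xs = as @ v # bs @ u # cs"
    then have "on_cycle (set xs) {v, u}" using * uv(3) ad_sym by blast
    then show ?thesis by (simp add: insert_commute)
  qed
qed

text \<open>As \<open>S - {b}\<close> is connected and contains \<open>c\<close>, the vertex
  \<open>a\<close> has a neighbour \<open>a'\<close> other than \<open>b\<close>; a path from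
  \<open>a'\<close> to \<open>b\<close> avoiding \<open>a\<close> closes up through
  \<open>a\<close>.\<close>

lemma edge_on_cycle:
  assumes S: "\<And>c. c \<in> S \<Longrightarrow> connected_in (S - {c})" and ab: "a \<in> S" "b \<in> S" "ad a b"
    and c: "c \<in> S" "c \<noteq> a" "c \<noteq> b"
  shows "on_cycle S {a, b}"
proof -
  have "a \<noteq> b" using ab by auto
  then have "{a} \<subseteq> S - {b}" "{a} \<noteq> S - {b}" using ab c by auto
  then have "\<not> closed_in {a} (S - {b})" using S[OF ab(2)] unfolding connected_in_def by blast
  then obtain a' where a': "a' \<in> S - {a}" "a' \<noteq> b" "ad a a'" unfolding closed_in_def by blast
  have "b \<in> S - {a}" using ab \<open>a \<noteq> b\<close> by simp
  then obtain xs where xs: "path_in (S - {a}) xs" "hd xs = a'" "last xs = b"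
    by (rule connected_in_path[OF S[OF ab(1)] a'(1)])
  have "xs \<noteq> []" using xs by (auto simp: path_in_def)
  moreover have "xs \<noteq> [x]" for x using xs(2,3) a'(2) by auto
  ultimately have "2 \<le> length xs" by (cases xs rule: path_weight.cases) auto
  then have "cycle_in S (a # xs)"
    using xs a' ab ad_sym[of a b] by (auto simp: cycle_in_def path_in_def successively_Cons)
  then show ?thesis unfolding on_cycle_def using \<open>xs \<noteq> []\<close> xs(3) by (intro exI[of _ "a # xs"]) simp
qed

lemma path_weight_conv_sum: "path_weight xs = (\<Sum>i<length xs - 1. wt (xs ! i) (xs ! Suc i))"
  by (induction xs rule: path_weight.induct) (auto simp: sum.lessThan_Suc_shift simp del: sum.lessThan_Suc)

lemma cycle_weight_conv_weight:
  assumes "cycle_in S xs"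
  shows "cycle_weight xs = weight w (cycle_edges xs)"
proof -
  let ?n = "length xs"
  define f where "f i = {xs ! i, xs ! ((i + 1) mod ?n)}" for i
  have n: "3 \<le> ?n" "distinct xs" "xs \<noteq> []" using assms by (auto simp: cycle_in_def path_in_def)
  \<comment> \<open>A repeated edge would make \<open>i\<close> and \<open>i + 2\<close> congruent
    modulo the length, which is at least 3.\<close>
  have "inj_on f {..<?n}"
  proof (rule inj_onI, rule ccontr)
    fix i j assume ij: "i \<in> {..<?n}" "j \<in> {..<?n}" "f i = f j" "i \<noteq> j"
    have "(i + 1) mod ?n < ?n" "(j + 1) mod ?n < ?n" using n by simp_all
    then have "i = (j + 1) mod ?n" "j = (i + 1) mod ?n"
      using ij n by (auto simp: f_def doubleton_eq_iff nth_eq_iff_index_eq)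
    moreover have "(k + 1) mod ?n = (if k + 1 = ?n then 0 else k + 1)" if "k < ?n" for k
      using that by auto
    ultimately show False using ij n by (auto split: if_splits)
  qed
  moreover have "cycle_edges xs = f ` {..<?n}" by (auto simp: cycle_edges_def f_def)
  ultimately have "weight w (cycle_edges xs) = (\<Sum>i<?n. w (f i))"
    by (simp add: weight_def sum.reindex)
  also have "\<dots> = (\<Sum>i<?n - 1. w (f i)) + w (f (?n - 1))"
    using n by (cases ?n) auto
  also have "(\<Sum>i<?n - 1. w (f i)) = path_weight xs"
  proof -
    have "ad (xs ! i) (xs ! Suc i)" if "i < ?n - 1" for i
      using assms that by (auto simp: cycle_in_def path_in_def successively_conv_nth)
    then show ?thesis unfolding path_weight_conv_sum by (intro sum.cong) (auto simp: f_def wt_def)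
  qed
  also have "w (f (?n - 1)) = wt (last xs) (hd xs)"
    using assms n by (auto simp: f_def wt_def cycle_in_def last_conv_nth hd_conv_nth)
  finally show ?thesis by (simp add: cycle_weight_def)
qed

lemma cycle_edges_subset:
  assumes "cycle_in S xs"
  shows "cycle_edges xs \<subseteq> E"
proof
  fix e assume "e \<in> cycle_edges xs"
  then obtain i where i: "e = {xs ! i, xs ! ((i + 1) mod length xs)}" "i < length xs"
    by (auto simp: cycle_edges_def)
  have c: "successively ad xs" "ad (last xs) (hd xs)" "xs \<noteq> []"
    using assms by (auto simp: cycle_in_def path_in_def)
  show "e \<in> E"
  proof (cases "Suc i = length xs")
    case True
    then have "xs ! i = last xs" using c(3) by (metis diff_Suc_1 last_conv_nth)
    then show ?thesis using i c True by (simp add: adj_def hd_conv_nth)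
  next
    case False
    then have "Suc i < length xs" using i(2) by simp
    then show ?thesis using i(1) c(1) by (simp add: successively_conv_nth adj_def)
  qed
qed

lemma hamiltonian_edges:
  assumes c: "cycle_in S xs" and ham: "\<And>ys. cycle_in S ys \<Longrightarrow> set ys = S"
  shows "edges S \<subseteq> cycle_edges xs"
proof
  fix e assume "e \<in> edges S"
  then obtain u v where e: "e = {u, v}" "u \<noteq> v" "u \<in> S" "v \<in> S" "ad u v" by (rule edgesE)
  have *: "{u, v} \<in> cycle_edges xs" if xs: "xs = as @ u # bs @ v # cs" and a: "ad u v" for u v as bs cs
  proof (cases "bs = []")
    case True
    then have "{u, v} = {xs ! length as, xs ! ((length as + 1) mod length xs)}" "length as < length xs"
      by (auto simp: xs nth_append)
    then show ?thesis unfolding cycle_edges_def by blast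
  next
    case False
    \<comment> \<open>The cycle cut off by the edge is Hamiltonian as well, so nothing lies outside
      this segment and \<open>u\<close>, \<open>v\<close> are joined by the closing edge.\<close>
    have eq: "set (u # bs @ [v]) = set xs" using ham cycle_chord[OF _ a False] c xs by blast
    have "distinct xs" using c by (auto simp: cycle_in_def path_in_def)
    then have "set as \<inter> set (u # bs @ [v]) = {}" "set cs \<inter> set (u # bs @ [v]) = {}"
      unfolding xs by auto
    moreover have "set as \<subseteq> set (u # bs @ [v])" "set cs \<subseteq> set (u # bs @ [v])"
      unfolding eq by (auto simp: xs)
    ultimately have "set as = {}" "set cs = {}" by (metis inf.orderE)+
    then have "as = []" "cs = []" by simp_all
    then have "{u, v} = {xs ! (length xs - 1), xs ! ((length xs - 1 + 1) mod length xs)}"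
      "length xs - 1 < length xs"
      by (auto simp: xs nth_append)
    then show ?thesis unfolding cycle_edges_def by blast
  qed
  have "u \<in> set xs" "v \<in> set xs" using e ham[OF c] by auto
  then have "{u, v} \<in> cycle_edges xs" using e(2)
  proof (rule split_two)
    fix as bs cs assume "xs = as @ u # bs @ v # cs"
    then show ?thesis using * e(5) by blast
  next
    fix as bs cs assume "xs = as @ v # bs @ u # cs"
    then have "{v, u} \<in> cycle_edges xs" using * e(5) ad_sym by blast
    then show ?thesis by (simp add: insert_commute)
  qed
  then show "e \<in> cycle_edges xs" by (simp add: e(1))
qed

lemma finite_cycles: "finite S \<Longrightarrow> finite {xs. cycle_in S xs}"
  by (rule finite_subset[OF _ finite_subset_distinct]) (auto simp: cycle_in_def path_in_def)

subsection \<open>Vertices, edges and bridges off a heaviest non-Hamiltonian cycle\<close>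

text \<open>The link together with either arc between \<open>u\<close> and \<open>v\<close> is a
  cycle. The two new weights add up to the old one plus twice the weight of the link.\<close>

lemma cycle_detour:
  assumes c: "cycle_in S (as @ u # bs @ v # cs)" and l: "link (S - set (as @ u # bs @ v # cs)) u ys v"
  shows "cycle_in S (as @ u # ys @ v # cs)" (is ?A)
    and "cycle_weight (as @ u # ys @ v # cs) =
      cycle_weight (as @ u # bs @ v # cs) - path_weight (u # bs @ [v]) + link_weight u ys v" (is ?B)
    and "cycle_in S (u # bs @ v # rev ys)" (is ?C)
    and "cycle_weight (u # bs @ v # rev ys) = path_weight (u # bs @ [v]) + link_weight u ys v" (is ?D)
proof -
  have p: "path_in S (as @ (u # bs @ [v]) @ cs)" "ad (last (v # cs)) (hd (as @ [u]))"
    using c by (auto simp: cycle_in_def hd_append split: if_splits)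
  have ys: "ys \<noteq> []" "path_in S ys" "set ys \<inter> set (as @ u # bs @ v # cs) = {}"
    "ad u (hd ys)" "ad (last ys) v" using l by (auto simp: link_def path_in_def)
  have as: "path_in S (as @ [u])" and bs: "path_in S (u # bs @ [v])" and cs: "path_in S (v # cs)"
    using path_in_infix[of S "[]" "as @ [u]" "bs @ v # cs"] path_in_infix[of S as "u # bs @ [v]" cs]
      path_in_infix[of S "as @ u # bs" "v # cs" "[]"] p(1) by simp_all
  have dis: "set (as @ [u]) \<inter> set (v # cs) = {}" using p(1) by (auto simp: path_in_def)
  have "path_in S (ys @ v # cs)" using ys cs by (subst path_in_append) auto
  then have "path_in S ((as @ [u]) @ (ys @ v # cs))"
    using ys as dis by (subst path_in_append) auto
  then show ?A using p(2) ys(1) by (cases ys) (auto simp: cycle_in_def hd_append)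
  have pw: "path_weight (as @ u # zs @ v # cs) =
    path_weight (as @ [u]) + path_weight (u # zs @ [v]) + path_weight (v # cs)" for zs
    using path_weight_split[of as u "zs @ v # cs"] path_weight_split[of "u # zs" v cs] by simp
  show ?B by (simp add: cycle_weight_def pw link_weight_def hd_append)
  have "path_in S ((u # bs @ [v]) @ rev ys)"
    using ys bs ad_sym[of "last ys" v] by (subst path_in_append) (auto simp: hd_rev)
  then show ?C using ys ad_sym[of u "hd ys"] by (cases ys) (auto simp: cycle_in_def last_rev)
  have "path_weight (u # bs @ v # rev ys) = path_weight (u # bs @ [v]) + path_weight (v # rev ys)"
    using path_weight_split[of "u # bs" v "rev ys"] by simp
  moreover have "path_weight (v # rev ys @ [u]) = path_weight (v # rev ys) + wt (last (rev ys)) u"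
    using path_weight_append[of "v # rev ys" "[u]"] ys(1) by simp
  moreover have "path_weight (v # rev ys @ [u]) = link_weight u ys v"
    using link_weight_rev[of v ys u] by (simp add: link_weight_def)
  ultimately show ?D using ys(1) by (simp add: cycle_weight_def)
qed

text \<open>\<open>degree_bound\<close> is applied to a component \<open>H\<close> off the cycle,
  with the attached cycle vertices as terminals, \<open>L = cycle_weight xs\<close> and
  \<open>\<delta> = M - cycle_weight xs\<close>. Its arc conditions say that neither cycle of
  \<open>cycle_detour\<close> weighs more than \<open>M\<close>.\<close>

lemma light_vertex_off_cycle:
  assumes S: "finite S" "\<And>c. c \<in> S \<Longrightarrow> connected_in (S - {c})" and C: "cycle_in S xs" "set xs \<noteq> S"
    and M: "\<And>ys. cycle_in S ys \<Longrightarrow> cycle_weight ys \<le> M"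
  obtains z where "z \<in> S - set xs"
    "2 * deg z S \<le> cycle_weight xs + length xs * (M - cycle_weight xs)"
proof -
  have xs: "set xs \<subseteq> S" "distinct xs" "3 \<le> length xs" using C by (auto simp: cycle_in_def path_in_def)
  have \<delta>: "0 \<le> M - cycle_weight xs" using M[OF C(1)] by simp
  obtain x y where xy: "x \<in> set xs" "y \<in> set xs" "x \<noteq> y"
    using xs(2,3) by (cases xs rule: path_weight.cases) auto
  obtain H where H: "H \<subseteq> S - set xs" "H \<noteq> {}" "closed_in H (S - set xs)" "connected_in H"
    using exists_component[of "S - set xs"] S(1) C(2) xs(1) by blast
  have fH: "finite H" using H S finite_subset by blast
  define us where "us = filter (attached H) xs"
  have us: "set us = {u \<in> set xs. attached H u}" "distinct us" "length us \<le> length xs"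
    using xs(2) by (auto simp: us_def)
  have len: "2 \<le> length us"
  proof -
    obtain p q where "p \<in> set us" "q \<in> set us" "p \<noteq> q"
      using two_attachments[OF S(2) xs(1) xy H(1-3)] us(1) by blast
    then have "card {p, q} \<le> card (set us)" by (intro card_mono) auto
    then show ?thesis using \<open>p \<noteq> q\<close> us(2) by (simp add: distinct_card)
  qed
  \<comment> \<open>Since \<open>S - {b}\<close> is connected, \<open>K\<close> has an edge leaving
    it there, and this edge can only end on the cycle.\<close>
  have "\<exists>u\<in>set us. attached K u" if b: "b \<in> H" "K \<subseteq> H - {b}" "K \<noteq> {}" "closed_in K (H - {b})" for b K
  proof -
    have "K \<subseteq> S - {b}" "K \<noteq> S - {b}" "b \<in> S" using b H xy xs(1) by auto
    then have "\<not> closed_in K (S - {b})" using S(2)[of b] b(3) unfolding connected_in_def by blast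
    then obtain k y where k: "k \<in> K" "y \<in> S - {b} - K" "ad k y" unfolding closed_in_def by blast
    have "y \<notin> H" using k b(4) unfolding closed_in_def by blast
    then have "y \<in> set xs" using k H(3) b(2) unfolding closed_in_def by blast
    then show ?thesis using k b(2) us(1) by (auto simp: attached_def)
  qed
  then have g: "nonseparable H (set us)" using H fH us(1) unfolding nonseparable_def by auto
  \<comment> \<open>The position of a vertex is its distance from \<open>hd xs\<close> along the
    cycle.\<close>
  define s where "s v = path_weight (takeWhile (\<lambda>y. y \<noteq> v) xs @ [v])" for v
  have "sorted_wrt (\<lambda>u v. \<forall>ys. link H u ys v \<longrightarrow>
    link_weight u ys v \<le> s v - s u + (M - cycle_weight xs) \<and>
    link_weight u ys v \<le> cycle_weight xs - (s v - s u) + (M - cycle_weight xs)) xs"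
  proof (rule sorted_wrtI_split, intro allI impI)
    fix as u bs v cs ys assume e: "xs = as @ u # bs @ v # cs" and l: "link H u ys v"
    have "link (S - set xs) u ys v" using l H(1) by (auto simp: link_def intro: path_in_mono)
    note d = cycle_detour[OF C(1)[unfolded e] this[unfolded e], folded e]
    have "takeWhile (\<lambda>y. y \<noteq> u) xs = as" "takeWhile (\<lambda>y. y \<noteq> v) xs = as @ u # bs"
      using xs(2) unfolding e by (auto simp: takeWhile_append takeWhile_eq_all_conv)
    then have "s v - s u = path_weight (u # bs @ [v])"
      using path_weight_split[of as u "bs @ [v]"] by (simp add: s_def)
    then show "link_weight u ys v \<le> s v - s u + (M - cycle_weight xs) \<and>
      link_weight u ys v \<le> cycle_weight xs - (s v - s u) + (M - cycle_weight xs)"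
      using M[OF d(1)] M[OF d(3)] d(2,4) by simp
  qed
  then have sorted: "sorted_wrt (\<lambda>u v. \<forall>ys. link H u ys v \<longrightarrow>
    link_weight u ys v \<le> s v - s u + (M - cycle_weight xs) \<and>
    link_weight u ys v \<le> cycle_weight xs - (s v - s u) + (M - cycle_weight xs)) us"
    unfolding us_def by (rule sorted_wrt_filter)
  \<comment> \<open>A vertex of least degree is chosen, so that its degree serves as
    \<open>d\<close>.\<close>
  have "Min ((\<lambda>v. deg v (H \<union> set us)) ` H) \<in> (\<lambda>v. deg v (H \<union> set us)) ` H" using fH H(2) by simp
  then obtain z where z: "z \<in> H" "deg z (H \<union> set us) = Min ((\<lambda>v. deg v (H \<union> set us)) ` H)" by auto
  have "2 * deg z (H \<union> set us) \<le> cycle_weight xs + length us * (M - cycle_weight xs)"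
    by (rule degree_bound[OF g us(2) len \<delta> _ sorted]) (use z fH in auto)
  moreover have "deg z S = deg z (H \<union> set us)"
    using S(1) H xs(1) us(1) z(1) by (intro deg_mono_neutral) (auto simp: closed_in_def attached_def)
  moreover have "length us * (M - cycle_weight xs) \<le> length xs * (M - cycle_weight xs)"
    using us(3) \<delta> by (intro mult_right_mono) auto
  ultimately show ?thesis using that[of z] z(1) H(1) by fastforce
qed

text \<open>A link through the edge gives two cycles of total weight \<open>cycle_weight xs\<close>
  plus twice the link. One of them is not Hamiltonian and weighs at most
  \<open>cycle_weight xs\<close>, the other at most \<open>M\<close>.\<close>

lemma light_edge_off_cycle:
  assumes S: "finite S" "\<And>c. c \<in> S \<Longrightarrow> connected_in (S - {c})" and C: "cycle_in S xs"
    and M: "\<And>ys. cycle_in S ys \<Longrightarrow> cycle_weight ys \<le> M"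
    and max: "\<And>ys. cycle_in S ys \<Longrightarrow> set ys \<noteq> S \<Longrightarrow> cycle_weight ys \<le> cycle_weight xs"
    and e: "a \<in> S" "b \<in> S" "ad a b" "\<not> {a, b} \<subseteq> set xs"
  shows "w {a, b} \<le> M / 2"
proof -
  have xs: "set xs \<subseteq> S" "distinct xs" "3 \<le> length xs" using C by (auto simp: cycle_in_def path_in_def)
  obtain x y where xy: "x \<in> set xs" "y \<in> set xs" "x \<noteq> y"
    using xs(2,3) by (cases xs rule: path_weight.cases) auto
  have *: "link_weight u ys v \<le> M / 2"
    if x: "xs = as @ u # bs @ v # cs" and l: "link (S - set xs) u ys v" for as u bs v cs ys
  proof -
    note d = cycle_detour[OF C[unfolded x] l[unfolded x], folded x]
    have ys: "set ys \<inter> set xs = {}" using l by (auto simp: link_def path_in_def)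
    \<comment> \<open>One of the two arcs has an inner vertex, which the cycle formed by the detour and the other
      arc misses; that cycle is not Hamiltonian.\<close>
    have "bs \<noteq> [] \<or> as @ cs \<noteq> []" using xs(3) x by auto
    then show ?thesis
    proof
      assume "bs \<noteq> []"
      then obtain b where "b \<in> set bs" by (cases bs) auto
      then have "b \<in> set xs" "b \<notin> set (as @ u # ys @ v # cs)" using xs(2) ys x by auto
      then have "cycle_weight (as @ u # ys @ v # cs) \<le> cycle_weight xs"
        using max[OF d(1)] xs(1) by blast
      then show ?thesis using d(2,4) M[OF d(3)] by simp
    next
      assume "as @ cs \<noteq> []"
      then obtain b where "b \<in> set (as @ cs)" by (cases "as @ cs") auto
      then have "b \<in> set xs" "b \<notin> set (u # bs @ v # rev ys)" using xs(2) ys x by auto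
      then have "cycle_weight (u # bs @ v # rev ys) \<le> cycle_weight xs"
        using max[OF d(3)] xs(1) by blast
      then show ?thesis using d(2,4) M[OF d(1)] by simp
    qed
  qed
  obtain u v ys where uv: "u \<in> set xs" "v \<in> set xs" "u \<noteq> v" "link (S - set xs) u ys v"
    "w {a, b} \<le> link_weight u ys v"
    using link_through_edge[OF S xs(1) xy e] by blast
  have "link_weight u ys v \<le> M / 2"
    using uv(1-3)
  proof (rule split_two)
    fix as bs cs assume "xs = as @ u # bs @ v # cs"
    then show ?thesis using * uv(4) by blast
  next
    fix as bs cs assume "xs = as @ v # bs @ u # cs"
    then show ?thesis using * link_rev[OF uv(4)] link_weight_rev by metis
  qed
  then show ?thesis using uv(5) by simp
qed

text \<open>Deleting the bridge separates its ends, and the cycle cannot cross the cut. The side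
  containing the cycle is taken as \<open>A\<close>, so \<open>b\<close> is the far end.\<close>

lemma bridge_cut:
  assumes C: "cycle_in S xs" and f: "f \<in> edges S" "\<not> on_cycle S f"
  shows "\<exists>b a A. f = {a, b} \<and> set xs \<subseteq> A \<and> A \<subseteq> S \<and> a \<in> A \<and> b \<in> S - A \<and>
    (\<forall>x\<in>A. \<forall>y\<in>S - A. ad x y \<longrightarrow> {x, y} = f)"
proof -
  obtain p q where pq: "f = {p, q}" "p \<noteq> q" "p \<in> S" "q \<in> S" "ad p q" using f(1) by (rule edgesE)
  have xs: "set xs \<subseteq> S" using C by (auto simp: cycle_in_def path_in_def)
  define R where "R x y \<longleftrightarrow> x \<in> S \<and> y \<in> S \<and> ad x y \<and> {x, y} \<noteq> f" for x y
  define A where "A = {v. (p, v) \<in> {(x, y). R x y}\<^sup>*}"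
  have Rsym: "R x y \<Longrightarrow> R y x" for x y using ad_sym by (auto simp: R_def insert_commute)
  have AR: "x \<in> A \<longleftrightarrow> y \<in> A" if "R x y" for x y
    using that Rsym[OF that] unfolding A_def by (auto intro: rtrancl.rtrancl_into_rtrancl)
  have AS: "A \<subseteq> S"
  proof
    fix v assume "v \<in> A"
    then have "(p, v) \<in> {(x, y). R x y}\<^sup>*" by (simp add: A_def)
    then show "v \<in> S" by (induction rule: rtrancl_induct) (auto simp: R_def pq(3))
  qed
  have pA: "p \<in> A" by (simp add: A_def)
  \<comment> \<open>A path from \<open>p\<close> to \<open>q\<close> avoiding \<open>f\<close> has
    at least three vertices and closes up with \<open>f\<close> to a cycle.\<close>
  have qA: "q \<notin> A"
  proof
    assume "q \<in> A"
    then have "(p, q) \<in> {(x, y). R x y}\<^sup>*" by (simp add: A_def)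
    then obtain ys where ys: "ys \<noteq> []" "hd ys = p" "last ys = q" "distinct ys"
      "successively (\<lambda>u v. (u, v) \<in> {(x, y). R x y}) ys"
      using rtrancl_distinct_path by metis
    then have R: "successively R ys" by simp
    then have "set ys \<subseteq> S \<and> successively (\<lambda>x y. ad x y \<and> {x, y} \<noteq> f) ys"
      using ys pq unfolding R_def by (intro successively_restrict) auto
    then have "path_in S ys"
      using ys by (auto simp: path_in_def elim: successively_mono)
    moreover have "3 \<le> length ys"
    proof (rule ccontr)
      assume "\<not> 3 \<le> length ys"
      moreover have "ys \<noteq> [x]" for x using ys pq by auto
      moreover have "ys \<noteq> [x, y]" for x y using ys R pq by (auto simp: R_def)
      ultimately show False using ys(1)
        by (cases ys rule: path_weight.cases) (auto simp: Suc_le_eq)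
    qed
    ultimately have "cycle_in S ys" using ys pq ad_sym by (simp add: cycle_in_def)
    then show False using f(2) ys pq unfolding on_cycle_def by blast
  qed
  have cross: "{x, y} = f" if "x \<in> S" "y \<in> S" "ad x y" "x \<in> A \<longleftrightarrow> y \<notin> A" for x y
    using AR[of x y] that by (auto simp: R_def)
  have "successively ad xs" using C by (simp add: cycle_in_def path_in_def)
  then have "set xs \<subseteq> A \<or> set xs \<inter> A = {}"
  proof (rule successively_invariant)
    fix x y assume xy: "x \<in> set xs" "y \<in> set xs" "ad x y"
    then have "on_cycle S {x, y}" using on_cycle_mono[OF on_cycle_vertices[OF C xy] xs] by blast
    then have "{x, y} \<noteq> f" using f(2) by blast
    then show "x \<in> A \<longleftrightarrow> y \<in> A" using AR[of x y] xy xs by (auto simp: R_def)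
  qed
  then show ?thesis
  proof
    assume "set xs \<subseteq> A"
    then show ?thesis using pq pA qA AS cross
      by (intro exI[of _ q] exI[of _ p] exI[of _ A]) auto
  next
    assume "set xs \<inter> A = {}"
    then show ?thesis using pq pA qA AS cross xs
      by (intro exI[of _ p] exI[of _ q] exI[of _ "S - A"]) auto
  qed
qed

text \<open>
  A bridge is mapped to its end on the far side from the cycle; two bridges with the same far end
  would both be needed to reach it from the cycle, which makes this map injective.
\<close>
lemma card_bridges:
  assumes S: "finite S" "connected_in S" and C: "cycle_in S xs"
  shows "card {f \<in> edges S. \<not> on_cycle S f} \<le> card (S - set xs)"
proof -
  let ?F = "{f \<in> edges S. \<not> on_cycle S f}"
  define far where "far f b \<longleftrightarrow> (\<exists>a A. f = {a, b} \<and> set xs \<subseteq> A \<and> A \<subseteq> S \<and> a \<in> A \<and> b \<in> S - A \<and>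
    (\<forall>x\<in>A. \<forall>y\<in>S - A. ad x y \<longrightarrow> {x, y} = f))" for f b
  have "\<exists>b. far f b" if "f \<in> ?F" for f
    unfolding far_def using that by (intro bridge_cut[OF C]) simp_all
  then have "\<forall>f\<in>?F. \<exists>b. far f b" by blast
  then obtain g where g: "\<forall>f\<in>?F. far f (g f)" by (rule bchoice[THEN exE])
  have "inj_on g ?F"
  proof (rule inj_onI, rule ccontr)
    fix f f' assume f: "f \<in> ?F" "f' \<in> ?F" "g f = g f'" "f \<noteq> f'"
    define b where "b = g f"
    have "far f b" "far f' b" using g f by (auto simp: b_def)
    then obtain a A a' A' where A: "f = {a, b}" "set xs \<subseteq> A" "A \<subseteq> S" "a \<in> A" "b \<in> S - A"
        "\<forall>x\<in>A. \<forall>y\<in>S - A. ad x y \<longrightarrow> {x, y} = f"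
      and A': "f' = {a', b}" "set xs \<subseteq> A'" "A' \<subseteq> S" "a' \<in> A'" "b \<in> S - A'"
        "\<forall>x\<in>A'. \<forall>y\<in>S - A'. ad x y \<longrightarrow> {x, y} = f'"
      unfolding far_def by blast
    have ad: "ad a b" "ad a' b"
      using f(1,2) A(1) A'(1) by (auto simp: edges_def adj_def)
    have n: "a' \<notin> A" "a \<notin> A'" using A(6) A'(6) A(5) A'(5) ad A(1) A'(1) f(4) by blast+
    \<comment> \<open>An edge leaving the intersection is \<open>f\<close> or \<open>f'\<close> and
      would have to start at \<open>a\<close> or \<open>a'\<close>, but neither lies in both
      sides.\<close>
    have "closed_in (A \<inter> A') S" unfolding closed_in_def
    proof (intro ballI notI)
      fix x y assume x: "x \<in> A \<inter> A'" and y: "y \<in> S - A \<inter> A'" and xy: "ad x y"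
      have "x \<noteq> b" using x A(5) by auto
      moreover have "{x, y} = {a, b} \<or> {x, y} = {a', b}" using A(1,6) A'(1,6) x y xy by blast
      ultimately show False using x n by (auto simp: doubleton_eq_iff)
    qed
    moreover have "hd xs \<in> A \<inter> A'" using A(2) A'(2) C by (auto simp: cycle_in_def path_in_def)
    moreover have "A \<inter> A' \<subseteq> S" using A(3) by blast
    ultimately have "A \<inter> A' = S" using connected_inD[OF S(2)] by metis
    then show False using A(5) by blast
  qed
  moreover have "g ` ?F \<subseteq> S - set xs" using g unfolding far_def by blast
  ultimately show ?thesis using S(1) by (intro card_inj_on_le[of g]) auto
qed

subsection \<open>The weight of a graph with light cycles\<close>

text \<open>The two parts share only \<open>c\<close>, so they share no edge, and every cycle stays
  in one part; hence each edge is a bridge of \<open>S\<close> exactly if it is one of its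
  part.\<close>

lemma sum_edge_value_cut_vertex:
  assumes S: "finite S" "c \<in> S" and K: "K \<subseteq> S - {c}" "closed_in K (S - {c})"
  shows "sum (edge_value M S) (edges S) =
    sum (edge_value M (insert c K)) (edges (insert c K)) + sum (edge_value M (S - K)) (edges (S - K))"
proof -
  have cyc: "set xs \<subseteq> insert c K \<or> set xs \<subseteq> S - K" if "cycle_in S xs" for xs
    using cycle_cut_vertex[OF that K(2)] that K(1) by (auto simp: cycle_in_def path_in_def)
  have eq: "on_cycle S e \<longleftrightarrow> on_cycle T e" if e: "e \<in> edges T" and T: "T = insert c K \<or> T = S - K" for e T
  proof
    assume "on_cycle S e"
    then obtain xs where xs: "cycle_in S xs" "e = {hd xs, last xs}" unfolding on_cycle_def by blast
    obtain a b where ab: "e = {a, b}" "a \<noteq> b" using e by (rule edgesE)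
    have "xs \<noteq> []" using xs by (auto simp: cycle_in_def path_in_def)
    then have "{a, b} \<subseteq> set xs" using xs(2) ab(1) by (metis hd_in_set last_in_set empty_subsetI insert_subset)
    moreover have "{a, b} \<subseteq> T" using e ab(1) by (simp add: edges_def)
    ultimately have "set xs \<subseteq> T" using cyc[OF xs(1)] T ab(2) K(1)
      by (elim disjE) auto
    then show "on_cycle T e" using xs by (auto simp: on_cycle_def cycle_in_def path_in_def)
  next
    assume "on_cycle T e"
    then show "on_cycle S e" by (rule on_cycle_mono) (use T S K in auto)
  qed
  have "edges S = edges (insert c K) \<union> edges (S - K)"
  proof (intro equalityI subsetI)
    fix e assume "e \<in> edges S"
    then obtain a b where "e = {a, b}" "a \<noteq> b" "a \<in> S" "b \<in> S" "ad a b" by (rule edgesE)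
    then show "e \<in> edges (insert c K) \<union> edges (S - K)"
      using K ad_sym[of a b] unfolding closed_in_def edges_def by (auto simp: adj_def)
  qed (use S K in \<open>auto simp: edges_def\<close>)
  moreover have "edges (insert c K) \<inter> edges (S - K) = {}"
  proof (intro equals0I)
    fix e assume e: "e \<in> edges (insert c K) \<inter> edges (S - K)"
    then obtain a b where "e = {a, b}" "a \<noteq> b" using edgesE by blast
    then show False using e K by (auto simp: edges_def)
  qed
  moreover have "finite (edges (insert c K))" "finite (edges (S - K))"
    using S K finite_subset[of K S] by (auto intro!: finite_edges)
  ultimately have "sum (edge_value M S) (edges S) =
    sum (edge_value M S) (edges (insert c K)) + sum (edge_value M S) (edges (S - K))"
    by (simp add: sum.union_disjoint)
  also have "sum (edge_value M S) (edges (insert c K)) = sum (edge_value M (insert c K)) (edges (insert c K))"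
    using eq by (intro sum.cong) (auto simp: edge_value_def)
  also have "sum (edge_value M S) (edges (S - K)) = sum (edge_value M (S - K)) (edges (S - K))"
    using eq by (intro sum.cong) (auto simp: edge_value_def)
  finally show ?thesis .
qed

text \<open>The induction hypothesis is taken for every cycle bound \<open>m\<close>, because
  deleting \<open>z\<close> may lower the bound.\<close>

lemma two_connected_edge_bound:
  assumes S: "finite S" "connected_in S" "\<And>c. c \<in> S \<Longrightarrow> connected_in (S - {c})" "3 \<le> card S"
    and M: "0 \<le> M" "\<And>ys. cycle_in S ys \<Longrightarrow> cycle_weight ys \<le> M"
    and IH: "\<And>z m. z \<in> S \<Longrightarrow> 0 \<le> m \<Longrightarrow> (\<And>ys. cycle_in (S - {z}) ys \<Longrightarrow> cycle_weight ys \<le> m) \<Longrightarrow>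
      sum (edge_value m (S - {z})) (edges (S - {z})) \<le> (real (card S) - 2) * m / 2"
  shows "sum (edge_value M S) (edges S) \<le> (real (card S) - 1) * M / 2"
proof -
  have on: "on_cycle S {a, b}" if "a \<in> S" "b \<in> S" "ad a b" for a b
  proof -
    have "\<not> S \<subseteq> {a, b}" using S(4) card_mono[of "{a, b}" S] card_insert_le_m1[of 2 "{b}" a] by force
    then show ?thesis using edge_on_cycle[OF S(3) that] by blast
  qed
  then have val: "sum (edge_value M S) (edges S) = sum w (edges S)"
    by (intro sum.cong) (auto simp: edge_value_def elim!: edgesE)
  show ?thesis
  proof (cases "\<exists>xs. cycle_in S xs \<and> set xs \<noteq> S")
    case False
    show ?thesis
    proof (cases "edges S = {}")
      case True
      then show ?thesis using S(4) M(1) by simp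
    next
      case ne: False
      then obtain xs where xs: "cycle_in S xs"
        using on edgesE unfolding on_cycle_def by (metis ex_in_conv)
      \<comment> \<open>With only Hamiltonian cycles, one cycle carries all edges; its weight
        \<open>M\<close> suffices as \<open>(card S - 1) / 2\<close> is at least 1.\<close>
      have "finite (cycle_edges xs)" by (simp add: cycle_edges_def)
      then have "sum w (edges S) \<le> weight w (cycle_edges xs)"
        unfolding weight_def using hamiltonian_edges[OF xs] False cycle_edges_subset[OF xs] weight_nonneg
        by (intro sum_mono2) auto
      also have "\<dots> \<le> M" using M(2)[OF xs] cycle_weight_conv_weight[OF xs] by simp
      also have "\<dots> \<le> (real (card S) - 1) / 2 * M"
        using S(4) M(1) mult_right_mono[of 1 "(real (card S) - 1) / 2" M] by simp
      finally show ?thesis using val by simp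
    qed
  next
    case True
    let ?N = "{xs. cycle_in S xs \<and> set xs \<noteq> S}"
    have "finite ?N" using finite_cycles[OF S(1)] by (rule rev_finite_subset) auto
    then have "Max (cycle_weight ` ?N) \<in> cycle_weight ` ?N"
      "\<And>ys. ys \<in> ?N \<Longrightarrow> cycle_weight ys \<le> Max (cycle_weight ` ?N)" using True by auto
    then obtain xs where "xs \<in> ?N" and max': "\<And>ys. ys \<in> ?N \<Longrightarrow> cycle_weight ys \<le> cycle_weight xs"
      by (metis (no_types, lifting) imageE)
    then have xs: "cycle_in S xs" "set xs \<noteq> S" by simp_all
    have max: "cycle_weight ys \<le> cycle_weight xs" if "cycle_in S ys" "set ys \<noteq> S" for ys
      using max' that by simp
    define m where "m = cycle_weight xs"
    have m: "0 \<le> m" "m \<le> M" using M(2)[OF xs(1)] by (auto simp: m_def cycle_weight_def)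
    obtain z where z: "z \<in> S - set xs" "2 * deg z S \<le> m + length xs * (M - m)"
      using light_vertex_off_cycle[OF S(1,3) xs M(2)] unfolding m_def by blast
    let ?S = "S - {z}"
    have xs': "cycle_in ?S xs" "distinct xs" "set xs \<subseteq> ?S"
      using xs(1) z(1) by (auto simp: cycle_in_def path_in_def)
    let ?F = "{f \<in> edges ?S. \<not> on_cycle ?S f}"
    have "w f \<le> edge_value m ?S f + (if f \<in> ?F then (M - m) / 2 else 0)" if f: "f \<in> edges ?S" for f
    proof (cases "on_cycle ?S f")
      case False
      obtain a b where ab: "f = {a, b}" "a \<noteq> b" "a \<in> ?S" "b \<in> ?S" "ad a b" using f by (rule edgesE)
      \<comment> \<open>An edge between two vertices of \<open>xs\<close> lies on a cycle inside
        \<open>xs\<close>, which avoids \<open>z\<close>.\<close>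
      then have "\<not> {a, b} \<subseteq> set xs"
        using on_cycle_mono[OF on_cycle_vertices[OF xs(1), of a b] xs'(3)] False by auto
      then have "w f \<le> M / 2"
        using light_edge_off_cycle[OF S(1,3) xs(1) M(2) max, of a b] ab by auto
      then show ?thesis using False f by (simp add: edge_value_def field_simps)
    qed (simp add: edge_value_def)
    then have "sum w (edges ?S) \<le> (\<Sum>f\<in>edges ?S. edge_value m ?S f + (if f \<in> ?F then (M - m) / 2 else 0))"
      by (rule sum_mono)
    also have "\<dots> = sum (edge_value m ?S) (edges ?S) + card ?F * ((M - m) / 2)"
      using finite_edges[of ?S] S(1) by (simp add: sum.distrib sum.If_cases Int_def)
    also have "sum (edge_value m ?S) (edges ?S) \<le> (real (card S) - 2) * m / 2"
    proof (rule IH[OF _ m(1)])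
      fix ys assume "cycle_in ?S ys"
      then have "cycle_in S ys" "set ys \<noteq> S" using z(1) by (auto simp: cycle_in_def path_in_def)
      then show "cycle_weight ys \<le> m" using max by (simp add: m_def)
    qed (use z in auto)
    also have "card ?F * ((M - m) / 2) \<le> (real (card S) - 1 - length xs) * ((M - m) / 2)"
    proof (rule mult_right_mono)
      have "card ?F \<le> card (?S - set xs)"
        using card_bridges[OF _ S(3) xs'(1)] S(1) z(1) by simp
      also have "\<dots> = card ?S - length xs"
        using xs'(2,3) S(1) by (simp add: card_Diff_subset distinct_card)
      finally have "card ?F + length xs \<le> card ?S"
        using card_mono[OF _ xs'(3)] S(1) by (simp add: distinct_card[OF xs'(2)])
      then show "real (card ?F) \<le> real (card S) - 1 - length xs"
        using card.remove[OF S(1), of z] z(1) by simp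
    qed (use m in simp)
    finally have "sum w (edges ?S) \<le>
      (real (card S) - 2) * m / 2 + (real (card S) - 1 - length xs) * ((M - m) / 2)" by simp
    moreover have "sum w (edges S) = deg z S + sum w (edges ?S)"
      using sum_edges_remove S(1) z(1) by simp
    \<comment> \<open>With \<open>n = card S\<close>, \<open>c = length xs\<close> and
      \<open>\<delta> = M - m\<close>, twice the total is at most \<open>m + c * \<delta> + (n - 2)
      * m + (n - 1 - c) * \<delta> = (n - 1) * M\<close>.\<close>
    ultimately show ?thesis using z(2) val by (simp add: algebra_simps) (simp add: field_simps)
  qed
qed

text \<open>At a cut vertex the parts have \<open>card K + 1\<close> and
  \<open>card S - card K\<close> vertices, so the bounds, linear in the number of vertices minus
  one, add up exactly.\<close>

lemma edge_value_bound:
  assumes "finite S" "S \<noteq> {}" "connected_in S" "0 \<le> M" "\<And>ys. cycle_in S ys \<Longrightarrow> cycle_weight ys \<le> M"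
  shows "sum (edge_value M S) (edges S) \<le> (real (card S) - 1) * M / 2"
  using assms
proof (induction "card S" arbitrary: S M rule: less_induct)
  case less
  show ?case
  proof (cases "\<forall>c\<in>S. connected_in (S - {c})")
    case False
    then obtain c K where c: "c \<in> S" and K: "K \<subseteq> S - {c}" "K \<noteq> {}" "closed_in K (S - {c})" "K \<noteq> S - {c}"
      unfolding connected_in_def by blast
    \<comment> \<open>Removing the other side \<open>L\<close> shows that \<open>insert c K\<close>
      is connected.\<close>
    define L where "L = S - {c} - K"
    have L: "L \<subseteq> S - {c}" "closed_in L (S - {c})" "S - L = insert c K"
      using c K closed_in_sym unfolding L_def by auto
    have connected_in: "connected_in (S - K)" "connected_in (insert c K)"
      using connected_in_remove_closed[OF less.prems(3) c K(1,3)] connected_in_remove_closed[OF less.prems(3) c L(1,2)] L(3)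
      by simp_all
    have fin: "finite K" "finite S" using K(1) less.prems(1) finite_subset by auto
    have cK: "c \<notin> K" "K \<subseteq> S" using K(1) by auto
    have "L \<noteq> {}" using K unfolding L_def by blast
    then have lt: "card (insert c K) < card S" "card (S - K) < card S"
      using c K fin L by (auto intro!: psubset_card_mono)
    have cards: "card (insert c K) = Suc (card K)" "card (S - K) + card K = card S"
      using cK fin card_mono[OF fin(2) cK(2)] by (simp_all add: card_Diff_subset)
    have "sum (edge_value M (insert c K)) (edges (insert c K)) \<le> (real (card (insert c K)) - 1) * M / 2"
    proof (rule less.hyps[OF lt(1) _ _ connected_in(2) less.prems(4)])
      fix ys assume "cycle_in (insert c K) ys"
      then show "cycle_weight ys \<le> M" using less.prems(5) cycle_in_mono c cK(2) by (metis insert_subset)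
    qed (use fin in auto)
    moreover have "sum (edge_value M (S - K)) (edges (S - K)) \<le> (real (card (S - K)) - 1) * M / 2"
    proof (rule less.hyps[OF lt(2) _ _ connected_in(1) less.prems(4)])
      fix ys assume "cycle_in (S - K) ys"
      then show "cycle_weight ys \<le> M" using less.prems(5) cycle_in_mono by (metis Diff_subset)
    qed (use fin c cK in auto)
    moreover have "(real (card (insert c K)) - 1) * M / 2 + (real (card (S - K)) - 1) * M / 2
      = (real (card S) - 1) * M / 2"
    proof -
      have "real (card S) = real (card (S - K)) + real (card K)" using cards(2) by linarith
      then show ?thesis by (simp add: cards(1) field_simps)
    qed
    ultimately show ?thesis using sum_edge_value_cut_vertex[OF fin(2) c K(1,3)] by simp
  next
    case True
    show ?thesis
    proof (cases "3 \<le> card S")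
      case card: True
      show ?thesis
      proof (rule two_connected_edge_bound[OF less.prems(1,3) _ card less.prems(4,5)])
        fix z m assume z: "z \<in> S" "0 \<le> m" "\<And>ys. cycle_in (S - {z}) ys \<Longrightarrow> cycle_weight ys \<le> m"
        have cS: "card S = Suc (card (S - {z}))" using card.remove[OF less.prems(1) z(1)] .
        then have "card (S - {z}) < card S" "real (card (S - {z})) - 1 = real (card S) - 2" by simp_all
        moreover have "S - {z} \<noteq> {}" using cS card by (metis card.empty One_nat_def numeral_le_one_iff semiring_norm(70))
        ultimately show "sum (edge_value m (S - {z})) (edges (S - {z})) \<le> (real (card S) - 2) * m / 2"
          using less.hyps[of "S - {z}" m] True z less.prems(1) by simp
      qed (use True in auto)
    next
      \<comment> \<open>With at most two vertices there is no cycle and at most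
        \<open>card S - 1\<close> edges, each of value \<open>M / 2\<close>.\<close>
      case small: False
      have no: "\<not> on_cycle S e" for e
      proof
        assume "on_cycle S e"
        then obtain xs where "set xs \<subseteq> S" "distinct xs" "3 \<le> length xs"
          by (auto simp: on_cycle_def cycle_in_def path_in_def)
        then show False using small card_mono[OF less.prems(1)] by (metis distinct_card order_trans)
      qed
      have "card (edges S) \<le> card S - 1"
      proof (cases "edges S = {}")
        case False
        then obtain e where e: "e \<in> edges S" by blast
        have "f = S" if f: "f \<in> edges S" for f
        proof -
          have "f \<subseteq> S" "card f = 2" using f card_edge by (auto simp: edges_def)
          then show ?thesis using small less.prems(1) by (intro card_seteq) auto
        qed
        then have "edges S \<subseteq> {S}" "e = S" using e by blast+
        moreover have "card e = 2" using e card_edge by (simp add: edges_def)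
        ultimately show ?thesis using card_mono[of "{S}" "edges S"] by simp
      qed simp
      then have "real (card (edges S)) \<le> real (card S) - 1"
        using less.prems(1,2) card_gt_0_iff[of S] by linarith
      then have "real (card (edges S)) * (M / 2) \<le> (real (card S) - 1) * (M / 2)"
        using less.prems(4) by (intro mult_right_mono) auto
      then show ?thesis using no by (simp add: edge_value_def)
    qed
  qed
qed

section \<open>Agreement with the cycles and connectedness of the theorem\<close>

lemma is_cycle_iff_cycle_in: "is_cycle V E xs \<longleftrightarrow> cycle_in V xs"
proof
  assume c: "is_cycle V E xs"
  then have xs: "xs \<noteq> []" "3 \<le> length xs" "distinct xs" "set xs \<subseteq> V" by (auto simp: is_cycle_def)
  have e: "{xs ! i, xs ! ((i + 1) mod length xs)} \<in> E" if "i < length xs" for i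
    using c that by (auto simp: is_cycle_def cycle_edges_def)
  have "successively ad xs"
    unfolding successively_conv_nth
  proof (intro allI impI)
    fix i assume "Suc i < length xs"
    then show "ad (xs ! i) (xs ! Suc i)" using e[of i] by (simp add: adj_def)
  qed
  moreover have "ad (last xs) (hd xs)"
    using e[of "length xs - 1"] xs(1) by (simp add: adj_def last_conv_nth hd_conv_nth)
  ultimately show "cycle_in V xs" using xs by (simp add: cycle_in_def path_in_def)
next
  assume "cycle_in V xs"
  then show "is_cycle V E xs"
    using cycle_edges_subset by (auto simp: is_cycle_def cycle_in_def path_in_def)
qed

lemma on_cycle_if_cycle_edge:
  assumes c: "cycle_in V xs" and e: "e \<in> cycle_edges xs"
  shows "on_cycle V e"
proof -
  obtain i where i: "e = {xs ! i, xs ! ((i + 1) mod length xs)}" "i < length xs"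
    using e by (auto simp: cycle_edges_def)
  then have "xs ! i \<in> set xs" "xs ! ((i + 1) mod length xs) \<in> set xs" by (auto intro!: nth_mem mod_less_divisor)
  moreover have "ad (xs ! i) (xs ! ((i + 1) mod length xs))"
    using cycle_edges_subset[OF c] e i by (auto simp: adj_def)
  ultimately have "on_cycle (set xs) e" unfolding i(1) by (rule on_cycle_vertices[OF c])
  then show ?thesis using c by (auto simp: cycle_in_def path_in_def intro: on_cycle_mono)
qed

lemma connected_in_if_connected_graph:
  assumes "connected_graph V E" "\<And>e. e \<in> E \<Longrightarrow> e \<subseteq> V"
  shows "connected_in V"
  unfolding connected_in_def
proof (intro allI impI)
  fix A assume A: "A \<subseteq> V" "A \<noteq> {}" "closed_in A V"
  then obtain a where a: "a \<in> A" by blast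
  have "v \<in> A" if "v \<in> V" for v
  proof -
    have "(a, v) \<in> {(x, y). adj E x y}\<^sup>*" using assms(1) a A(1) that by (auto simp: connected_graph_def)
    then show ?thesis
    proof (induction rule: rtrancl_induct)
      case (step y z)
      then have "z \<in> V" using assms(2)[of "{y, z}"] by (simp add: adj_def)
      then show ?case using step A(3) unfolding closed_in_def by blast
    qed (rule a)
  qed
  then show "A = V" using A(1) by blast
qed

end

subsection \<open>Normalising the weights\<close>

lemma finite_cycle_weights:
  assumes "finite V"
  shows "finite {weight w (cycle_edges xs) |xs. is_cycle V E xs \<and> e \<in> cycle_edges xs}"
proof -
  have "finite {xs. set xs \<subseteq> V \<and> distinct xs}" using assms by (rule finite_subset_distinct)
  then have "finite {xs. is_cycle V E xs \<and> e \<in> cycle_edges xs}"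
    by (rule rev_finite_subset) (auto simp: is_cycle_def)
  then show ?thesis by (rule finite_image_set)
qed

lemma weight_le_Cw:
  assumes "finite V" "is_cycle V E xs" "e \<in> cycle_edges xs"
  shows "weight w (cycle_edges xs) \<le> Cw V E w e"
proof -
  have "weight w (cycle_edges xs) \<le> Max {weight w (cycle_edges xs) |xs. is_cycle V E xs \<and> e \<in> cycle_edges xs}"
    using finite_cycle_weights[OF assms(1)] by (rule Max_ge) (use assms in blast)
  then show ?thesis using assms unfolding Cw_def by auto
qed

lemma weight_cycle_pos:
  assumes "is_cycle V E xs" "\<And>e. e \<in> E \<Longrightarrow> w e > 0"
  shows "0 < weight w (cycle_edges xs)"
proof -
  have "{xs ! 0, xs ! ((0 + 1) mod length xs)} \<in> cycle_edges xs"
    using assms(1) unfolding cycle_edges_def is_cycle_def by fastforce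
  moreover have "finite (cycle_edges xs)" by (simp add: cycle_edges_def)
  ultimately show ?thesis
    unfolding weight_def using assms by (intro sum_pos) (auto simp: is_cycle_def)
qed

lemma Cw_pos:
  assumes "finite V" "\<And>e. e \<in> E \<Longrightarrow> w e > 0" "e \<in> E"
  shows "0 < Cw V E w e"
proof (cases "\<exists>xs. is_cycle V E xs \<and> e \<in> cycle_edges xs")
  case True
  then show ?thesis using weight_le_Cw weight_cycle_pos assms by (metis less_le_trans)
next
  case False
  then show ?thesis using assms(2,3) by (auto simp: Cw_def)
qed

theorem theorem2p1:
  fixes V :: "'a set" and E :: "'a set set" and w :: "'a set \<Rightarrow> real"
  assumes "simple_graph V E"
    and "connected_graph V E"
    and "\<And>e. e \<in> E \<Longrightarrow> w e > 0"
  shows "(\<Sum>e\<in>E. w e / Cw V E w e) \<le> (real (card V) - 1) / 2"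
proof -
  define u where "u e = w e / Cw V E w e" for e
  have V: "finite V" "V \<noteq> {}" and E: "\<And>e. e \<in> E \<Longrightarrow> e \<subseteq> V \<and> card e = 2"
    using assms(1,2) by (auto simp: simple_graph_def connected_graph_def)
  have pos: "0 < Cw V E w e" if "e \<in> E" for e using Cw_pos[of V E w e] V(1) assms(3) that by blast
  interpret weighted_graph E u
    using E assms(3) pos by unfold_locales (auto simp: u_def intro: divide_nonneg_pos less_imp_le)
  have cycles: "cycle_weight xs \<le> 1" if "cycle_in V xs" for xs
  proof -
    have c: "is_cycle V E xs" using that by (simp add: is_cycle_iff_cycle_in)
    have p: "0 < weight w (cycle_edges xs)" using weight_cycle_pos[OF c] assms(3) by blast
    have "cycle_weight xs = (\<Sum>e\<in>cycle_edges xs. w e / Cw V E w e)"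
      unfolding cycle_weight_conv_weight[OF that] by (simp add: weight_def u_def)
    \<comment> \<open>For each edge of this cycle the maximum \<open>Cw V E w e\<close> is at least
      the weight of the cycle itself.\<close>
    also have "\<dots> \<le> (\<Sum>e\<in>cycle_edges xs. w e / weight w (cycle_edges xs))"
    proof (rule sum_mono)
      fix e assume e: "e \<in> cycle_edges xs"
      then have "0 < w e" using cycle_edges_subset[OF that] assms(3) by blast
      then show "w e / Cw V E w e \<le> w e / weight w (cycle_edges xs)"
        using weight_le_Cw[OF V(1) c e, of w] p by (intro divide_left_mono) auto
    qed
    also have "\<dots> = 1" using p by (simp add: weight_def flip: sum_divide_distrib)
    finally show ?thesis .
  qed
  \<comment> \<open>On a cycle both sides are \<open>u e\<close>; for a bridge
    \<open>Cw V E w e = 2 * w e\<close> makes both sides \<open>1/2\<close>.\<close>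
  have "u e \<le> edge_value 1 V e" if e: "e \<in> E" for e
  proof (cases "on_cycle V e")
    case False
    then have "Cw V E w e = 2 * w e"
      using on_cycle_if_cycle_edge is_cycle_iff_cycle_in by (auto simp: Cw_def)
    then show ?thesis using False assms(3)[OF e] by (simp add: edge_value_def u_def)
  qed (simp add: edge_value_def)
  then have "sum u E \<le> sum (edge_value 1 V) E" by (rule sum_mono)
  moreover have "edges V = E" using E by (auto simp: edges_def)
  moreover have "sum (edge_value 1 V) (edges V) \<le> (real (card V) - 1) * 1 / 2"
    using V connected_in_if_connected_graph[OF assms(2)] E cycles by (intro edge_value_bound) auto
  ultimately show ?thesis by (simp add: u_def)
qed

end
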